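(* Let $(A,C)_\psi$ be an entwining structure over a field $k$. Then $C_\psi(A)=\bigoplus_{n\ge0}C^n_\psi(A)$ is an associative algebra with the product $\sqcup$ given, for $f\in C^m_\psi(A)$, $g\in C^n_\psi(A)$, by $$(f\sqcup g)(c,a^1,\ldots,a^{m+n})=f(c_{(2)},a^1,\ldots,a^m)_\alpha\, g(c_{(1)}{}^\alpha,a^{m+1},\ldots,a^{m+n}).$$ Furthermore, $d$ is a degree 1 derivation in this algebra, i.e., $d(f\sqcup g)=df\sqcup g+(-1)^mf\sqcup dg$ for all $f\in C^m_\psi(A)$, $g\in C^n_\psi(A)$.
   Context: $k$ is a field, $\otimes=\otimes_k$; algebras are associative and unital, coalgebras are coassociative and counital; $\mathrm{Hom}$ means $k$-linear maps; $V^n=V^{\otimes n}$ (with $V^0=k$); $\Delta(c)=c_{(1)}\otimes c_{(2)}$ and $\epsilon$ are the coproduct and counit of $C$. An entwining structure $(A,C)_\psi$ consists of an algebra $A$, a coalgebra $C$ and a $k$-linear map $\psi:C\otimes A\to A\otimes C$, written $\psi(c\otimes a)=a_\alpha\otimes c^\alpha$ (summation understood; repeated application uses further Greek indices), such that for all $a,a'\in A$, $c\in C$: $(aa')_\alpha\otimes c^\alpha=a_\alpha a'_\beta\otimes c^{\alpha\beta}$; $1_\alpha\otimes c^\alpha=1\otimes c$; $a_\alpha\otimes (c^\alpha)_{(1)}\otimes (c^\alpha)_{(2)}=a_{\beta\alpha}\otimes c_{(1)}{}^\alpha\otimes c_{(2)}{}^\beta$; $a_\alpha\epsilon(c^\alpha)=a\epsilon(c)$.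 $C^n_\psi(A)=\mathrm{Hom}(C\otimes A^n,A)$, $n\ge0$, with coboundary $$df(c,a^1,\ldots,a^{n+1})=a^1_\alpha f(c^\alpha,a^2,\ldots,a^{n+1})+\sum_{i=1}^n(-1)^if(c,a^1,\ldots,a^ia^{i+1},\ldots,a^{n+1})+(-1)^{n+1}f(c,a^1,\ldots,a^n)a^{n+1}$$ for $f\in C_\psi^n(A)$. *)

theory Defs
  imports
    Complex_Main
    "HOL-Library.Poly_Mapping"
    "HOL-Library.Set_Algebras"
    "HOL-Library.Function_Algebras"
begin

section \<open>Tensor products over a field\<close>

text \<open>
  A vector space over a field \<open>'k\<close> is a type with a scalar multiplication that satisfies
  \<^locale>\<open>vector_space\<close>. A tensor product is the quotient of the free vector space
  \<open>'x \<Rightarrow>\<^sub>0 'k\<close> on a type \<open>'x\<close> of tuples (or lists) by the span of the multilinearity relations.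
  Its elements are cosets \<open>x +o N\<close>. They are added with the elementwise addition of
  \<^theory>\<open>HOL-Library.Set_Algebras\<close>.
\<close>

definition fscale :: "'k::field \<Rightarrow> ('x \<Rightarrow>\<^sub>0 'k) \<Rightarrow> ('x \<Rightarrow>\<^sub>0 'k)"
  where "fscale r x = Poly_Mapping.map ((*) r) x"

definition gen :: "'x \<Rightarrow> ('x \<Rightarrow>\<^sub>0 'k::field)"
  where "gen p = Poly_Mapping.single p 1"

text \<open>The relations that make \<open>v \<mapsto> gen (u v)\<close> linear modulo their span; \<open>u\<close> places the vector
  \<open>v\<close> into one slot of a tuple whose other entries are fixed.\<close>

definition slot_rels :: "('k::field \<Rightarrow> 'v::ab_group_add \<Rightarrow> 'v) \<Rightarrow> ('v \<Rightarrow> 'x) \<Rightarrow> ('x \<Rightarrow>\<^sub>0 'k) set"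
  where "slot_rels s u =
    {gen (u (v + w)) - gen (u v) - gen (u w) | v w. True} \<union>
    {gen (u (s r v)) - fscale r (gen (u v)) | r v. True}"

definition rels2 ::
  "('k::field \<Rightarrow> 'v::ab_group_add \<Rightarrow> 'v) \<Rightarrow> ('k \<Rightarrow> 'w::ab_group_add \<Rightarrow> 'w) \<Rightarrow> ('v \<times> 'w \<Rightarrow>\<^sub>0 'k) set"
  where "rels2 s t = module.span fscale
    ((\<Union>w. slot_rels s (\<lambda>v. (v, w))) \<union> (\<Union>v. slot_rels t (\<lambda>w. (v, w))))"

definition rels3 ::
  "('k::field \<Rightarrow> 'v::ab_group_add \<Rightarrow> 'v) \<Rightarrow> ('k \<Rightarrow> 'w::ab_group_add \<Rightarrow> 'w) \<Rightarrow>
   ('k \<Rightarrow> 'u::ab_group_add \<Rightarrow> 'u) \<Rightarrow> ('v \<times> 'w \<times> 'u \<Rightarrow>\<^sub>0 'k) set"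
  where "rels3 s t q = module.span fscale
    ((\<Union>w u. slot_rels s (\<lambda>v. (v, w, u))) \<union> (\<Union>v u. slot_rels t (\<lambda>w. (v, w, u))) \<union>
     (\<Union>v w. slot_rels q (\<lambda>u. (v, w, u))))"

text \<open>For \<open>V \<otimes> W\<^bsup>\<otimes>n\<^esup>\<close> the free generators are the pairs \<open>(v, ws)\<close> with \<open>length ws = n\<close>. For
  \<open>n = 0\<close> only the slot of \<open>v\<close> remains, so that \<open>V \<otimes> W\<^bsup>\<otimes>0\<^esup> = V \<otimes> k\<close> is \<open>V\<close>.\<close>

definition relsn ::
  "('k::field \<Rightarrow> 'v::ab_group_add \<Rightarrow> 'v) \<Rightarrow> ('k \<Rightarrow> 'w::ab_group_add \<Rightarrow> 'w) \<Rightarrow> nat \<Rightarrow>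
   ('v \<times> 'w list \<Rightarrow>\<^sub>0 'k) set"
  where "relsn s t n = module.span fscale
    ((\<Union>ws\<in>{ws. length ws = n}. slot_rels s (\<lambda>v. (v, ws))) \<union>
     (\<Union>v. \<Union>ws\<in>{ws. length ws = n}. \<Union>i\<in>{..<n}. slot_rels t (\<lambda>w. (v, ws[i := w]))))"

definition space2 ::
  "('k::field \<Rightarrow> 'v::ab_group_add \<Rightarrow> 'v) \<Rightarrow> ('k \<Rightarrow> 'w::ab_group_add \<Rightarrow> 'w) \<Rightarrow>
   ('v \<times> 'w \<Rightarrow>\<^sub>0 'k) set set"
  where "space2 s t = {x +o rels2 s t | x. True}"

definition spacen ::
  "('k::field \<Rightarrow> 'v::ab_group_add \<Rightarrow> 'v) \<Rightarrow> ('k \<Rightarrow> 'w::ab_group_add \<Rightarrow> 'w) \<Rightarrow> nat \<Rightarrow>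
   ('v \<times> 'w list \<Rightarrow>\<^sub>0 'k) set set"
  where "spacen s t n = {x +o relsn s t n | x. \<forall>p\<in>Poly_Mapping.keys x. length (snd p) = n}"

definition tens2 ::
  "('k::field \<Rightarrow> 'v::ab_group_add \<Rightarrow> 'v) \<Rightarrow> ('k \<Rightarrow> 'w::ab_group_add \<Rightarrow> 'w) \<Rightarrow> 'v \<Rightarrow> 'w \<Rightarrow>
   ('v \<times> 'w \<Rightarrow>\<^sub>0 'k) set"
  where "tens2 s t v w = gen (v, w) +o rels2 s t"

definition tensn ::
  "('k::field \<Rightarrow> 'v::ab_group_add \<Rightarrow> 'v) \<Rightarrow> ('k \<Rightarrow> 'w::ab_group_add \<Rightarrow> 'w) \<Rightarrow> 'v \<Rightarrow> 'w list \<Rightarrow>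
   ('v \<times> 'w list \<Rightarrow>\<^sub>0 'k) set"
  where "tensn s t v ws = gen (v, ws) +o relsn s t (length ws)"

text \<open>Scalar multiplication on the quotient by \<open>N\<close>; adding \<open>N\<close> only matters for \<open>r = 0\<close>.\<close>

definition qscale :: "('x \<Rightarrow>\<^sub>0 'k::field) set \<Rightarrow> 'k \<Rightarrow> ('x \<Rightarrow>\<^sub>0 'k) set \<Rightarrow> ('x \<Rightarrow>\<^sub>0 'k) set"
  where "qscale N r X = fscale r ` X + N"

definition lin_map ::
  "'v::plus set \<Rightarrow> ('k::field \<Rightarrow> 'v \<Rightarrow> 'v) \<Rightarrow> 'w::plus set \<Rightarrow> ('k \<Rightarrow> 'w \<Rightarrow> 'w) \<Rightarrow> ('v \<Rightarrow> 'w) \<Rightarrow> bool"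
  where "lin_map V s W t f \<longleftrightarrow>
    (\<forall>x\<in>V. f x \<in> W) \<and>
    (\<forall>x\<in>V. \<forall>y\<in>V. f (x + y) = f x + f y) \<and>
    (\<forall>r. \<forall>x\<in>V. f (s r x) = t r (f x))"

text \<open>
  The summation convention: \<open>sweedler s T h\<close> is the sum of \<open>h\<close> over the terms of a formal sum that
  represents the tensor \<open>T\<close>. So if \<open>\<Delta> c = \<Sum> c\<^sub>1 \<otimes> c\<^sub>2\<close>, then \<open>sweedler s (\<Delta> c) h = \<Sum> h (c\<^sub>1, c\<^sub>2)\<close>.
  The value does not depend on the chosen representative when \<open>h\<close> is multilinear
  (lemma \<open>sweedler_coset\<close>).
\<close>

definition fsum :: "('k::field \<Rightarrow> 'u::ab_group_add \<Rightarrow> 'u) \<Rightarrow> ('x \<Rightarrow> 'u) \<Rightarrow> ('x \<Rightarrow>\<^sub>0 'k) \<Rightarrow> 'u"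
  where "fsum s h x = (\<Sum>p\<in>Poly_Mapping.keys x. s (Poly_Mapping.lookup x p) (h p))"

definition sweedler ::
  "('k::field \<Rightarrow> 'u::ab_group_add \<Rightarrow> 'u) \<Rightarrow> ('x \<Rightarrow>\<^sub>0 'k) set \<Rightarrow> ('x \<Rightarrow> 'u) \<Rightarrow> 'u"
  where "sweedler s T h = fsum s h (SOME x. x \<in> T)"

lemma lookup_fscale: "Poly_Mapping.lookup (fscale r x) p = r * Poly_Mapping.lookup x p"
  unfolding fscale_def by transfer (auto simp: when_def)

lemma module_fscale: "module (fscale :: 'k::field \<Rightarrow> ('x \<Rightarrow>\<^sub>0 'k) \<Rightarrow> _)"
  by unfold_locales (auto intro!: poly_mapping_eqI simp: lookup_fscale lookup_add algebra_simps)

lemma fsum_superset: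
  assumes "vector_space s" "finite A" "Poly_Mapping.keys x \<subseteq> A"
  shows "fsum s h x = (\<Sum>p\<in>A. s (Poly_Mapping.lookup x p) (h p))"
proof -
  interpret vector_space s by fact
  show ?thesis unfolding fsum_def
    by (rule sum.mono_neutral_left) (use assms in \<open>auto simp: in_keys_iff\<close>)
qed

lemma module_hom_fsum:
  fixes s :: "'k::field \<Rightarrow> 'u::ab_group_add \<Rightarrow> 'u" and h :: "'x \<Rightarrow> 'u"
  assumes "vector_space s"
  shows "module_hom fscale s (fsum s h)"
proof -
  interpret vector_space s by fact
  interpret f: module "fscale :: 'k \<Rightarrow> ('x \<Rightarrow>\<^sub>0 'k) \<Rightarrow> _" by (rule module_fscale)
  show ?thesis
  proof unfold_locales
    fix x y :: "'x \<Rightarrow>\<^sub>0 'k" and r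
    let ?A = "Poly_Mapping.keys x \<union> Poly_Mapping.keys y"
    have "Poly_Mapping.keys (x + y) \<subseteq> ?A" by (rule Poly_Mapping.keys_add)
    then show "fsum s h (x + y) = fsum s h x + fsum s h y"
      by (simp add: fsum_superset[OF assms, of ?A] lookup_add scale_left_distrib sum.distrib)
    have "Poly_Mapping.keys (fscale r x) \<subseteq> Poly_Mapping.keys x"
      by (auto simp: in_keys_iff lookup_fscale)
    then show "fsum s h (fscale r x) = s r (fsum s h x)"
      by (simp add: fsum_superset[OF assms, of "Poly_Mapping.keys x"] lookup_fscale scale_sum_right)
  qed
qed

lemma sweedler_coset:
  assumes "vector_space s" and vanish: "\<And>y. y \<in> R \<Longrightarrow> fsum s h y = 0"
  shows "sweedler s (x +o module.span fscale R) h = fsum s h x"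
proof -
  interpret module_hom fscale s "fsum s h" by (rule module_hom_fsum) fact
  have "x \<in> x +o m1.span R"
    using m1.span_zero by (force simp: elt_set_plus_def)
  then have "(SOME y. y \<in> x +o m1.span R) \<in> x +o m1.span R"
    by (rule someI)
  then obtain n where "n \<in> m1.span R" and some: "(SOME y. y \<in> x +o m1.span R) = x + n"
    by (auto simp: elt_set_plus_def)
  then have "fsum s h n = 0"
    using eq_0_on_span[OF vanish] by blast
  then show ?thesis
    by (simp add: sweedler_def some add)
qed

section \<open>Algebras, coalgebras and entwining structures\<close>

text \<open>An associative unital algebra carried by a subspace \<open>S\<close> of a vector space type. The unit may
  be zero.\<close>

definition assoc_algebra ::
  "('k::field \<Rightarrow> 'v::ab_group_add \<Rightarrow> 'v) \<Rightarrow> 'v set \<Rightarrow> ('v \<Rightarrow> 'v \<Rightarrow> 'v) \<Rightarrow> 'v \<Rightarrow> bool"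
  where "assoc_algebra s S mul e \<longleftrightarrow>
    vector_space s \<and> module.subspace s S \<and>
    (\<forall>x\<in>S. lin_map S s S s (mul x)) \<and>
    (\<forall>y\<in>S. lin_map S s S s (\<lambda>x. mul x y)) \<and>
    (\<forall>x\<in>S. \<forall>y\<in>S. \<forall>z\<in>S. mul (mul x y) z = mul x (mul y z)) \<and>
    e \<in> S \<and> (\<forall>x\<in>S. mul e x = x \<and> mul x e = x)"

locale coalgebra = vector_space sC
  for sC :: "'k::field \<Rightarrow> 'c::ab_group_add \<Rightarrow> 'c"
    and \<Delta> :: "'c \<Rightarrow> ('c \<times> 'c \<Rightarrow>\<^sub>0 'k) set"
    and \<epsilon> :: "'c \<Rightarrow> 'k" +
  assumes comult_linear: "lin_map UNIV sC (space2 sC sC) (qscale (rels2 sC sC)) \<Delta>"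
    and counit_linear: "lin_map UNIV sC UNIV (*) \<epsilon>"
    and coassoc:
      "sweedler fscale (\<Delta> c) (\<lambda>(c1, c2). sweedler fscale (\<Delta> c1) (\<lambda>(c11, c12). gen (c11, c12, c2)))
         +o rels3 sC sC sC =
       sweedler fscale (\<Delta> c) (\<lambda>(c1, c2). sweedler fscale (\<Delta> c2) (\<lambda>(c21, c22). gen (c1, c21, c22)))
         +o rels3 sC sC sC"
    and counit_left: "sweedler sC (\<Delta> c) (\<lambda>(c1, c2). sC (\<epsilon> c1) c2) = c"
    and counit_right: "sweedler sC (\<Delta> c) (\<lambda>(c1, c2). sC (\<epsilon> c2) c1) = c"

text \<open>The sort \<open>{ring, monoid_mult}\<close> is that of unital rings in which \<open>0 = 1\<close> is allowed.\<close>

locale entwining = coalgebra sC \<Delta> \<epsilon>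
  for sA :: "'k::field \<Rightarrow> 'a::{ring, monoid_mult} \<Rightarrow> 'a"
    and sC :: "'k \<Rightarrow> 'c::ab_group_add \<Rightarrow> 'c"
    and \<Delta> :: "'c \<Rightarrow> ('c \<times> 'c \<Rightarrow>\<^sub>0 'k) set"
    and \<epsilon> :: "'c \<Rightarrow> 'k"
    and \<psi> :: "('c \<times> 'a \<Rightarrow>\<^sub>0 'k) set \<Rightarrow> ('a \<times> 'c \<Rightarrow>\<^sub>0 'k) set" +
  assumes algebra: "assoc_algebra sA UNIV (*) 1"
    and entwine_linear:
      "lin_map (space2 sC sA) (qscale (rels2 sC sA)) (space2 sA sC) (qscale (rels2 sA sC)) \<psi>"
    and entwine_mult:
      "\<psi> (tens2 sC sA c (a * a')) =
       sweedler fscale (\<psi> (tens2 sC sA c a)) (\<lambda>(a1, c1).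
         sweedler fscale (\<psi> (tens2 sC sA c1 a')) (\<lambda>(a2, c2). gen (a1 * a2, c2)))
       +o rels2 sA sC"
    and entwine_one: "\<psi> (tens2 sC sA c 1) = tens2 sA sC 1 c"
    and entwine_comult:
      "sweedler fscale (\<psi> (tens2 sC sA c a)) (\<lambda>(a1, c').
         sweedler fscale (\<Delta> c') (\<lambda>(c1, c2). gen (a1, c1, c2)))
         +o rels3 sA sC sC =
       sweedler fscale (\<Delta> c) (\<lambda>(c1, c2).
         sweedler fscale (\<psi> (tens2 sC sA c2 a)) (\<lambda>(b, c2').
           sweedler fscale (\<psi> (tens2 sC sA c1 b)) (\<lambda>(b', c1'). gen (b', c1', c2'))))
         +o rels3 sA sC sC"
    and entwine_counit:
      "sweedler sA (\<psi> (tens2 sC sA c a)) (\<lambda>(a1, c1). sA (\<epsilon> c1) a1) = sA (\<epsilon> c) a"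

section \<open>The cochain complex of an entwining structure\<close>

text \<open>Linear maps from \<open>C \<otimes> A\<^bsup>\<otimes>n\<^esup>\<close> to \<open>A\<close>, extended by zero outside \<open>C \<otimes> A\<^bsup>\<otimes>n\<^esup>\<close> so that equal
  cochains are equal functions.\<close>

type_synonym ('k, 'c, 'a) cochain = "('c \<times> 'a list \<Rightarrow>\<^sub>0 'k) set \<Rightarrow> 'a"

definition cochains ::
  "('k::field \<Rightarrow> 'a::{ring, monoid_mult} \<Rightarrow> 'a) \<Rightarrow> ('k \<Rightarrow> 'c::ab_group_add \<Rightarrow> 'c) \<Rightarrow> nat \<Rightarrow>
   ('k, 'c, 'a) cochain set"
  where "cochains sA sC n =
    {f. lin_map (spacen sC sA n) (qscale (relsn sC sA n)) UNIV sA f \<and>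
        (\<forall>X. X \<notin> spacen sC sA n \<longrightarrow> f X = 0)}"

text \<open>The cochain of degree \<open>n\<close> with values \<open>h (c, as)\<close> on pure tensors, for multilinear \<open>h\<close>.\<close>

definition cochain_of ::
  "('k::field \<Rightarrow> 'a::{ring, monoid_mult} \<Rightarrow> 'a) \<Rightarrow> ('k \<Rightarrow> 'c::ab_group_add \<Rightarrow> 'c) \<Rightarrow> nat \<Rightarrow>
   ('c \<times> 'a list \<Rightarrow> 'a) \<Rightarrow> ('k, 'c, 'a) cochain"
  where "cochain_of sA sC n h = (\<lambda>X. if X \<in> spacen sC sA n then sweedler sA X h else 0)"

definition cup_val ::
  "('k::field \<Rightarrow> 'a::{ring, monoid_mult} \<Rightarrow> 'a) \<Rightarrow> ('k \<Rightarrow> 'c::ab_group_add \<Rightarrow> 'c) \<Rightarrow>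
   ('c \<Rightarrow> ('c \<times> 'c \<Rightarrow>\<^sub>0 'k) set) \<Rightarrow> (('c \<times> 'a \<Rightarrow>\<^sub>0 'k) set \<Rightarrow> ('a \<times> 'c \<Rightarrow>\<^sub>0 'k) set) \<Rightarrow>
   nat \<Rightarrow> ('k, 'c, 'a) cochain \<Rightarrow> ('k, 'c, 'a) cochain \<Rightarrow> 'c \<times> 'a list \<Rightarrow> 'a"
  where "cup_val sA sC \<Delta> \<psi> m f g = (\<lambda>(c, as).
    sweedler sA (\<Delta> c) (\<lambda>(c1, c2).
      sweedler sA (\<psi> (tens2 sC sA c1 (f (tensn sC sA c2 (take m as))))) (\<lambda>(b, c1').
        b * g (tensn sC sA c1' (drop m as)))))"

definition cup ::
  "('k::field \<Rightarrow> 'a::{ring, monoid_mult} \<Rightarrow> 'a) \<Rightarrow> ('k \<Rightarrow> 'c::ab_group_add \<Rightarrow> 'c) \<Rightarrow>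
   ('c \<Rightarrow> ('c \<times> 'c \<Rightarrow>\<^sub>0 'k) set) \<Rightarrow> (('c \<times> 'a \<Rightarrow>\<^sub>0 'k) set \<Rightarrow> ('a \<times> 'c \<Rightarrow>\<^sub>0 'k) set) \<Rightarrow>
   nat \<Rightarrow> nat \<Rightarrow> ('k, 'c, 'a) cochain \<Rightarrow> ('k, 'c, 'a) cochain \<Rightarrow> ('k, 'c, 'a) cochain"
  where "cup sA sC \<Delta> \<psi> m n f g = cochain_of sA sC (m + n) (cup_val sA sC \<Delta> \<psi> m f g)"

text \<open>Lists are indexed from \<open>0\<close>: the arguments \<open>a\<^sup>1, \<dots>, a\<^bsup>n+1\<^esup>\<close> are \<open>as ! 0, \<dots>, as ! n\<close>. Signs are
  scalars in \<open>k\<close>.\<close>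

definition cobd_val ::
  "('k::field \<Rightarrow> 'a::{ring, monoid_mult} \<Rightarrow> 'a) \<Rightarrow> ('k \<Rightarrow> 'c::ab_group_add \<Rightarrow> 'c) \<Rightarrow>
   (('c \<times> 'a \<Rightarrow>\<^sub>0 'k) set \<Rightarrow> ('a \<times> 'c \<Rightarrow>\<^sub>0 'k) set) \<Rightarrow>
   nat \<Rightarrow> ('k, 'c, 'a) cochain \<Rightarrow> 'c \<times> 'a list \<Rightarrow> 'a"
  where "cobd_val sA sC \<psi> n f = (\<lambda>(c, as).
    sweedler sA (\<psi> (tens2 sC sA c (as ! 0))) (\<lambda>(b, c'). b * f (tensn sC sA c' (drop 1 as)))
    + (\<Sum>i = 1..n. sA ((-1) ^ i)
        (f (tensn sC sA c (take (i - 1) as @ [as ! (i - 1) * as ! i] @ drop (i + 1) as))))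
    + sA ((-1) ^ (n + 1)) (f (tensn sC sA c (take n as)) * as ! n))"

definition cobd ::
  "('k::field \<Rightarrow> 'a::{ring, monoid_mult} \<Rightarrow> 'a) \<Rightarrow> ('k \<Rightarrow> 'c::ab_group_add \<Rightarrow> 'c) \<Rightarrow>
   (('c \<times> 'a \<Rightarrow>\<^sub>0 'k) set \<Rightarrow> ('a \<times> 'c \<Rightarrow>\<^sub>0 'k) set) \<Rightarrow>
   nat \<Rightarrow> ('k, 'c, 'a) cochain \<Rightarrow> ('k, 'c, 'a) cochain"
  where "cobd sA sC \<psi> n f = cochain_of sA sC (n + 1) (cobd_val sA sC \<psi> n f)"

text \<open>Elements of the direct sum over all degrees are families of cochains with finite support. The
  vector space operations are pointwise.\<close>

definition cochain_sum ::
  "('k::field \<Rightarrow> 'a::{ring, monoid_mult} \<Rightarrow> 'a) \<Rightarrow> ('k \<Rightarrow> 'c::ab_group_add \<Rightarrow> 'c) \<Rightarrow>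
   (nat \<Rightarrow> ('k, 'c, 'a) cochain) set"
  where "cochain_sum sA sC = {F. (\<forall>n. F n \<in> cochains sA sC n) \<and> finite {n. F n \<noteq> 0}}"

definition sum_scale ::
  "('k::field \<Rightarrow> 'a::{ring, monoid_mult} \<Rightarrow> 'a) \<Rightarrow> 'k \<Rightarrow> (nat \<Rightarrow> ('k, 'c, 'a) cochain) \<Rightarrow>
   (nat \<Rightarrow> ('k, 'c, 'a) cochain)"
  where "sum_scale sA r F = (\<lambda>n X. sA r (F n X))"

definition homog :: "nat \<Rightarrow> ('k, 'c, 'a::zero) cochain \<Rightarrow> (nat \<Rightarrow> ('k, 'c, 'a) cochain)"
  where "homog n f = (\<lambda>i. if i = n then f else 0)"

definition sum_cup ::
  "('k::field \<Rightarrow> 'a::{ring, monoid_mult} \<Rightarrow> 'a) \<Rightarrow> ('k \<Rightarrow> 'c::ab_group_add \<Rightarrow> 'c) \<Rightarrow>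
   ('c \<Rightarrow> ('c \<times> 'c \<Rightarrow>\<^sub>0 'k) set) \<Rightarrow> (('c \<times> 'a \<Rightarrow>\<^sub>0 'k) set \<Rightarrow> ('a \<times> 'c \<Rightarrow>\<^sub>0 'k) set) \<Rightarrow>
   (nat \<Rightarrow> ('k, 'c, 'a) cochain) \<Rightarrow> (nat \<Rightarrow> ('k, 'c, 'a) cochain) \<Rightarrow> (nat \<Rightarrow> ('k, 'c, 'a) cochain)"
  where "sum_cup sA sC \<Delta> \<psi> F G = (\<lambda>n. \<Sum>i\<le>n. cup sA sC \<Delta> \<psi> i (n - i) (F i) (G (n - i)))"

definition sum_cobd ::
  "('k::field \<Rightarrow> 'a::{ring, monoid_mult} \<Rightarrow> 'a) \<Rightarrow> ('k \<Rightarrow> 'c::ab_group_add \<Rightarrow> 'c) \<Rightarrow>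
   (('c \<times> 'a \<Rightarrow>\<^sub>0 'k) set \<Rightarrow> ('a \<times> 'c \<Rightarrow>\<^sub>0 'k) set) \<Rightarrow>
   (nat \<Rightarrow> ('k, 'c, 'a) cochain) \<Rightarrow> (nat \<Rightarrow> ('k, 'c, 'a) cochain)"
  where "sum_cobd sA sC \<psi> F = (\<lambda>n. case n of 0 \<Rightarrow> 0 | Suc i \<Rightarrow> cobd sA sC \<psi> i (F i))"

end

(*
  A cochain of degree n is a family of linear maps C -> A, indexed by lists of n elements of A.
  On Hom(C, A) there is a twisted convolution (F * G)(c) = F(c_2)_alpha G(c_1^alpha) and an action
  (a . G)(c) = a_alpha G(c^alpha) of A. The entwining axioms say that the convolution is associative
  with unit epsilon, that (a b) . G = a . (b . G), that a . (F * G) = (a . F) * G and that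
  (F a) * G = F * (a . G). The cup product is the convolution of the values of f and g on the two
  parts of the argument list, so associativity is inherited; in the Leibniz rule all terms match one
  by one, except that the last term of df in the cup product of df and g
  cancels the first term of dg in that of f and dg, by the last identity.
*)
theory Submission
  imports Defs
begin

text \<open>The obstacle is that \<open>sweedler\<close> sums over an arbitrarily chosen
  representative of a tensor, so a sum is known to be independent of that choice only when its
  summand is multilinear. An axiom stated between cosets is therefore used by applying a multilinear
  A-valued function to both sides, which turns it into an identity of iterated sums in A. The
  linearity lemmas come in two kinds: dependence on the tensor, which passes through the quotient
  and rests on a multilinear summand, and dependence on a parameter of the summand, where the tensor
  and its representative stay fixed. The way back from functions to cochains is
  \<open>cochain_of_cochains\<close> (existence) and \<open>cochain_eqI\<close> (uniqueness),
  together the universal property of the tensor product.\<close>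

interpretation free: module "fscale :: 'k::field \<Rightarrow> ('x \<Rightarrow>\<^sub>0 'k) \<Rightarrow> _"
  by (rule module_fscale)

section \<open>Cosets and summation over representatives\<close>

lemma coset_add: "(x +o free.span R) + (y +o free.span R) = (x + y) +o free.span R"
proof -
  have "free.span R + free.span R = free.span R"
    by (auto simp: set_plus_def intro: free.span_add)
      (metis add.right_neutral free.span_zero)
  then show ?thesis
    by (simp add: set_plus_rearrange)
qed

lemma coset_eqI:
  assumes "x - y \<in> free.span R"
  shows "x +o free.span R = y +o free.span R"
proof -
  have "x +o free.span R = y +o ((x - y) +o free.span R)"
    by (simp add: set_plus_rearrange2)
  also have "(x - y) +o free.span R = free.span R"
  proof (rule set_eqI)
    fix z
    have "z \<in> (x - y) +o free.span R \<longleftrightarrow> z - (x - y) \<in> free.span R"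
      by (force simp: elt_set_plus_def)
    also have "\<dots> \<longleftrightarrow> z \<in> free.span R"
      using free.span_add_eq2[of "x - y" R "z - (x - y)"] assms by simp
    finally show "z \<in> (x - y) +o free.span R \<longleftrightarrow> z \<in> free.span R" .
  qed
  finally show ?thesis by simp
qed

lemma qscale_coset: "qscale (free.span R) r (x +o free.span R) = fscale r x +o free.span R"
proof (rule set_eqI, rule iffI)
  fix z assume "z \<in> qscale (free.span R) r (x +o free.span R)"
  then obtain p q where "p \<in> free.span R" "q \<in> free.span R" "z = fscale r (x + p) + q"
    by (auto simp: qscale_def set_plus_def elt_set_plus_def)
  then show "z \<in> fscale r x +o free.span R"
    by (auto simp: elt_set_plus_def free.scale_right_distrib add.assoc
        intro!: free.span_add free.span_scale)
next
  fix z assume "z \<in> fscale r x +o free.span R"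
  then obtain q where "q \<in> free.span R" "z = fscale r (x + 0) + q"
    by (auto simp: elt_set_plus_def)
  then show "z \<in> qscale (free.span R) r (x +o free.span R)"
    unfolding qscale_def elt_set_plus_def set_plus_def
    using free.span_zero by blast
qed

section \<open>Linearity of sums over a representative\<close>

lemma poly_mapping_expand: "x = (\<Sum>p\<in>Poly_Mapping.keys x. fscale (Poly_Mapping.lookup x p) (gen p))"
  by (rule poly_mapping_eqI)
    (auto simp: lookup_sum lookup_fscale gen_def lookup_single when_def in_keys_iff if_distrib
      cong: if_cong)

lemma fsum_gen: "vector_space s \<Longrightarrow> fsum s h (gen p) = h p"
  by (simp add: fsum_def gen_def vector_space_def)

lemma module_homI:
  assumes "vector_space s" "vector_space t"
    and "\<And>x y. L (x + y) = L x + L y" "\<And>r x. L (s r x) = t r (L x)"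
  shows "module_hom s t L"
  using assms by (auto simp: module_hom_def module_hom_axioms_def module_iff_vector_space)

lemma sweedler_add:
  assumes "vector_space s"
  shows "sweedler s T (\<lambda>p. h p + k p) = sweedler s T h + sweedler s T k"
proof -
  interpret vector_space s by fact
  show ?thesis
    by (simp add: sweedler_def fsum_def scale_right_distrib sum.distrib)
qed

text \<open>Both sides sum over the same chosen representative of \<open>T\<close>, so linearity of
  \<open>L\<close> alone moves it inside.\<close>

lemma module_hom_sweedler:
  assumes "module_hom s t L"
  shows "L (sweedler s T h) = sweedler t T (\<lambda>p. L (h p))"
proof -
  interpret module_hom s t L by fact
  show ?thesis
    by (simp add: sweedler_def fsum_def sum scale)
qed

lemma module_hom_sweedler_body:
  assumes s: "vector_space s" and q: "vector_space q" and "\<And>p. module_hom q s (\<lambda>x. h x p)"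
  shows "module_hom q s (\<lambda>x. sweedler s T (h x))"
proof (rule module_homI)
  fix x y r
  interpret vector_space s by fact
  have "h (x + y) = (\<lambda>p. h x p + h y p)" "h (q r x) = (\<lambda>p. s r (h x p))"
    using module_hom.add[OF assms(3)] module_hom.scale[OF assms(3)] by auto
  moreover have hom: "module_hom s s (s r)"
    by (rule module_homI[OF s s]) (simp_all add: scale_right_distrib mult.commute)
  ultimately show "sweedler s T (h (x + y)) = sweedler s T (h x) + sweedler s T (h y)"
    "sweedler s T (h (q r x)) = s r (sweedler s T (h x))"
    using module_hom_sweedler[OF hom, of T "h x"] by (simp_all add: sweedler_add[OF s])
qed fact+

text \<open>The source of all independence of representatives: \<open>fsum\<close> is linear in the
  formal sum and kills the generating relations of every slot in which \<open>h\<close> is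
  linear.\<close>

lemma fsum_slot_rels:
  assumes "y \<in> slot_rels s u" "vector_space t" "module_hom s t (\<lambda>v. h (u v))"
  shows "fsum t h y = 0"
proof -
  interpret module_hom s t "\<lambda>v. h (u v)" by fact
  interpret f: module_hom fscale t "fsum t h" by (rule module_hom_fsum) fact
  from assms(1) show ?thesis
    by (auto simp: slot_rels_def f.diff f.scale fsum_gen[OF assms(2)] add scale)
qed

lemma sweedler_coset2:
  assumes "vector_space t" "\<And>w. module_hom s t (\<lambda>v. h (v, w))" "\<And>v. module_hom s' t (\<lambda>w. h (v, w))"
  shows "sweedler t (x +o rels2 s s') h = fsum t h x"
  unfolding rels2_def
  by (rule sweedler_coset[OF assms(1)]) (auto elim!: fsum_slot_rels intro: assms)

lemma sweedler_coset3:
  assumes "vector_space t" "\<And>w u. module_hom s t (\<lambda>v. h (v, w, u))"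
    "\<And>v u. module_hom s' t (\<lambda>w. h (v, w, u))" "\<And>v w. module_hom s'' t (\<lambda>u. h (v, w, u))"
  shows "sweedler t (x +o rels3 s s' s'') h = fsum t h x"
  unfolding rels3_def
  by (rule sweedler_coset[OF assms(1)]) (auto elim!: fsum_slot_rels intro: assms)

lemma sweedler_space2:
  assumes t: "vector_space t"
    and h: "\<And>w. module_hom s t (\<lambda>v. h (v, w))" "\<And>v. module_hom s' t (\<lambda>w. h (v, w))"
    and X: "X \<in> space2 s s'"
  shows "Y \<in> space2 s s' \<Longrightarrow> sweedler t (X + Y) h = sweedler t X h + sweedler t Y h"
    and "sweedler t (qscale (rels2 s s') r X) h = t r (sweedler t X h)"
proof -
  interpret f: module_hom fscale t "fsum t h" by (rule module_hom_fsum) fact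
  note c = sweedler_coset2[OF t h]
  obtain x where x: "X = x +o rels2 s s'"
    using X by (auto simp: space2_def)
  then show "sweedler t (qscale (rels2 s s') r X) h = t r (sweedler t X h)"
    using c[of "fscale r x"] c[of x] by (simp add: rels2_def qscale_coset f.scale)
  assume "Y \<in> space2 s s'"
  then obtain y where "Y = y +o rels2 s s'"
    by (auto simp: space2_def)
  with x show "sweedler t (X + Y) h = sweedler t X h + sweedler t Y h"
    using c[of "x + y"] c[of x] c[of y] by (simp add: rels2_def coset_add f.add)
qed

section \<open>Pure tensors\<close>

lemma tens2_in_space2: "tens2 s t v w \<in> space2 s t"
  by (auto simp: tens2_def space2_def)

text \<open>The formal sums behind the two sides differ by one generator of the relations. Keeping
  the placement \<open>u\<close> abstract covers the slots of pairs and of lists alike.\<close>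

lemma coset_slot:
  assumes "slot_rels s u \<subseteq> R"
  shows "gen (u (v + w)) +o free.span R = (gen (u v) +o free.span R) + (gen (u w) +o free.span R)"
    and "gen (u (s r v)) +o free.span R = qscale (free.span R) r (gen (u v) +o free.span R)"
  unfolding coset_add qscale_coset using assms
  by (auto intro!: coset_eqI free.span_base subsetD[OF assms])
    (auto simp: slot_rels_def diff_diff_eq[symmetric])

lemma tens2_linear:
  "tens2 s t (v + v') w = tens2 s t v w + tens2 s t v' w"
  "tens2 s t v (w + w') = tens2 s t v w + tens2 s t v w'"
  "tens2 s t (s r v) w = qscale (rels2 s t) r (tens2 s t v w)"
  "tens2 s t v (t r w) = qscale (rels2 s t) r (tens2 s t v w)"
  unfolding tens2_def rels2_def
  by (rule coset_slot[where u = "\<lambda>v. (v, w)"] coset_slot[where u = "\<lambda>w. (v, w)"]; blast)+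

lemma tensn_linear:
  shows "tensn s t (v + v') ws = tensn s t v ws + tensn s t v' ws"
    and "tensn s t (s r v) ws = qscale (relsn s t (length ws)) r (tensn s t v ws)"
    and "i < length ws \<Longrightarrow>
      tensn s t v (ws[i := w + w']) = tensn s t v (ws[i := w]) + tensn s t v (ws[i := w'])"
    and "i < length ws \<Longrightarrow>
      tensn s t v (ws[i := t r w]) = qscale (relsn s t (length ws)) r (tensn s t v (ws[i := w]))"
  unfolding tensn_def relsn_def length_list_update
  by (rule coset_slot[where u = "\<lambda>v. (v, ws)"] coset_slot[where u = "\<lambda>w. (v, ws[i := w])"]; blast)+

lemma tensn_in_spacen: "length ws = n \<Longrightarrow> tensn s t v ws \<in> spacen s t n"
  by (auto simp: tensn_def spacen_def gen_def)

section \<open>Closure properties of linear maps\<close>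

lemma module_hom_plus:
  assumes "module_hom s t L" "module_hom s t M"
  shows "module_hom s t (\<lambda>x. L x + M x)"
proof -
  interpret L: module_hom s t L by fact
  interpret M: module_hom s t M by fact
  show ?thesis
    by unfold_locales (simp_all add: L.add M.add L.scale M.scale L.m2.scale_right_distrib)
qed

lemma module_hom_sum:
  assumes "vector_space s" "vector_space t" "\<And>i. i \<in> I \<Longrightarrow> module_hom s t (L i)"
  shows "module_hom s t (\<lambda>x. \<Sum>i\<in>I. L i x)"
proof (rule module_homI)
  fix x y r
  interpret t: vector_space t by fact
  show "(\<Sum>i\<in>I. L i (x + y)) = (\<Sum>i\<in>I. L i x) + (\<Sum>i\<in>I. L i y)"
    "(\<Sum>i\<in>I. L i (s r x)) = t r (\<Sum>i\<in>I. L i x)"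
    using module_hom.add[OF assms(3)] module_hom.scale[OF assms(3)]
    by (simp_all add: sum.distrib t.scale_sum_right)
qed fact+

lemma module_hom_scaled:
  assumes "module_hom s t L"
  shows "module_hom s t (\<lambda>x. t r (L x))"
proof -
  interpret L: module_hom s t L by fact
  show ?thesis
    by unfold_locales (simp_all add: L.add L.scale L.m2.scale_right_distrib mult.commute)
qed

lemma module_hom_comp:
  assumes "module_hom s t L" "module_hom q s M"
  shows "module_hom q t (\<lambda>x. L (M x))"
  using module_hom_compose[OF assms(2,1)] by (simp add: o_def)

section \<open>The twisted convolution on linear maps from the coalgebra to the algebra\<close>

context entwining
begin

lemma vector_space_algebra: "vector_space sA"
  using algebra by (simp add: assoc_algebra_def)

sublocale A: vector_space sA
  by (rule vector_space_algebra)

lemma vector_space_coalgebra: "vector_space sC"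
  by unfold_locales

lemma module_hom_mult:
  "module_hom sA sA (\<lambda>x. x * y)" "module_hom sA sA (\<lambda>x. y * x)"
  using algebra
  by (auto intro!: module_homI[OF vector_space_algebra vector_space_algebra]
      simp: assoc_algebra_def lin_map_def distrib_left distrib_right)

lemmas scale_mult =
  module_hom.scale[OF module_hom_mult(1)] module_hom.scale[OF module_hom_mult(2)]

lemma module_hom_times:
  "module_hom q sA L \<Longrightarrow> module_hom q sA (\<lambda>x. L x * y)"
  "module_hom q sA L \<Longrightarrow> module_hom q sA (\<lambda>x. y * L x)"
  by (rule module_hom_comp[OF module_hom_mult(1)] module_hom_comp[OF module_hom_mult(2)]; assumption)+

section \<open>Sums over the coproduct and over the entwining map, with values in the
  algebra\<close>

definition comult_sum :: "'c \<Rightarrow> ('c \<Rightarrow> 'c \<Rightarrow> 'a) \<Rightarrow> 'a"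
  where "comult_sum c h = sweedler sA (\<Delta> c) (\<lambda>(c1, c2). h c1 c2)"

definition entwine_sum :: "'c \<Rightarrow> 'a \<Rightarrow> ('a \<Rightarrow> 'c \<Rightarrow> 'a) \<Rightarrow> 'a"
  where "entwine_sum c a h = sweedler sA (\<psi> (tens2 sC sA c a)) (\<lambda>(b, c'). h b c')"

lemma comult_sum_hom:
  assumes "\<And>c2. module_hom sC sA (\<lambda>c1. h c1 c2)" "\<And>c1. module_hom sC sA (h c1)"
  shows "module_hom sC sA (\<lambda>c. comult_sum c h)"
  using comult_linear sweedler_space2[of sA sC "\<lambda>(c1, c2). h c1 c2" sC, OF vector_space_algebra]
  by (auto intro!: module_homI[OF vector_space_coalgebra vector_space_algebra]
      simp: comult_sum_def lin_map_def assms)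

lemma entwine_sum_hom:
  assumes "\<And>c. module_hom sA sA (\<lambda>b. h b c)" "\<And>b. module_hom sC sA (h b)"
  shows "module_hom sC sA (\<lambda>c. entwine_sum c a h)"
    and "module_hom sA sA (\<lambda>a. entwine_sum c a h)"
  using entwine_linear sweedler_space2[of sA sA "\<lambda>(b, c). h b c" sC, OF vector_space_algebra]
  by (auto intro!: module_homI[OF vector_space_coalgebra vector_space_algebra]
      module_homI[OF vector_space_algebra vector_space_algebra]
      simp: entwine_sum_def tens2_linear tens2_in_space2 lin_map_def assms)

lemma comult_sum_body_hom:
  assumes "vector_space q" "\<And>c1 c2. module_hom q sA (\<lambda>x. h x c1 c2)"
  shows "module_hom q sA (\<lambda>x. comult_sum c (h x))"
  unfolding comult_sum_def
  by (rule module_hom_sweedler_body) (auto simp: vector_space_algebra assms)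

lemma entwine_sum_body_hom:
  assumes "vector_space q" "\<And>b c. module_hom q sA (\<lambda>x. h x b c)"
  shows "module_hom q sA (\<lambda>x. entwine_sum c a (h x))"
  unfolding entwine_sum_def
  by (rule module_hom_sweedler_body) (auto simp: vector_space_algebra assms)

lemma hom_comult_sum:
  "module_hom sA sA L \<Longrightarrow> L (comult_sum c h) = comult_sum c (\<lambda>c1 c2. L (h c1 c2))"
  unfolding comult_sum_def by (subst module_hom_sweedler) (auto simp: case_prod_unfold)

lemma hom_entwine_sum:
  "module_hom sA sA L \<Longrightarrow> L (entwine_sum c a h) = entwine_sum c a (\<lambda>b c'. L (h b c'))"
  unfolding entwine_sum_def by (subst module_hom_sweedler) (auto simp: case_prod_unfold)

section \<open>The axioms as identities of iterated sums\<close>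

lemma fsum_sweedler_hom:
  "fsum sA h (sweedler fscale T k) = sweedler sA T (\<lambda>p. fsum sA h (k p))"
  by (rule module_hom_sweedler[OF module_hom_fsum[OF vector_space_algebra]])

lemmas fsum_sweedler = fsum_sweedler_hom fsum_gen[OF vector_space_algebra] case_prod_unfold

text \<open>The axiom equates two cosets of the triple tensor product. Evaluating the trilinear
  \<open>h\<close> on both is legitimate, and \<open>fsum\<close>, being linear, passes through the
  nested sums down to the generators. The next lemmas treat the entwining axioms in the same
  way.\<close>

lemma coassoc_sum:
  assumes "\<And>y z. module_hom sC sA (\<lambda>x. h x y z)" "\<And>x z. module_hom sC sA (\<lambda>y. h x y z)"
    "\<And>x y. module_hom sC sA (\<lambda>z. h x y z)"
  shows "comult_sum c (\<lambda>c1 c2. comult_sum c1 (\<lambda>c11 c12. h c11 c12 c2)) =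
    comult_sum c (\<lambda>c1 c2. comult_sum c2 (\<lambda>c21 c22. h c1 c21 c22))"
  using arg_cong[OF coassoc[of c], of "\<lambda>T. sweedler sA T (\<lambda>(x, y, z). h x y z)"]
  by (simp add: sweedler_coset3 vector_space_algebra assms fsum_sweedler comult_sum_def)

lemma entwine_comult_sum:
  assumes "\<And>y z. module_hom sA sA (\<lambda>x. h x y z)" "\<And>x z. module_hom sC sA (\<lambda>y. h x y z)"
    "\<And>x y. module_hom sC sA (\<lambda>z. h x y z)"
  shows "entwine_sum c a (\<lambda>b c'. comult_sum c' (\<lambda>c1 c2. h b c1 c2)) =
    comult_sum c (\<lambda>c1 c2. entwine_sum c2 a (\<lambda>b c2'. entwine_sum c1 b (\<lambda>b' c1'. h b' c1' c2')))"
  using arg_cong[OF entwine_comult[of c a], of "\<lambda>T. sweedler sA T (\<lambda>(x, y, z). h x y z)"]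
  by (simp add: sweedler_coset3 vector_space_algebra assms fsum_sweedler comult_sum_def entwine_sum_def)

lemma entwine_mult_sum:
  assumes "\<And>c. module_hom sA sA (\<lambda>b. h b c)" "\<And>b. module_hom sC sA (h b)"
  shows "entwine_sum c (a * a') h =
    entwine_sum c a (\<lambda>a1 c1. entwine_sum c1 a' (\<lambda>a2 c2. h (a1 * a2) c2))"
  using arg_cong[OF entwine_mult[of c a a'], of "\<lambda>T. sweedler sA T (\<lambda>(x, y). h x y)"]
  by (simp add: sweedler_coset2 vector_space_algebra assms fsum_sweedler entwine_sum_def)

lemma entwine_one_sum:
  assumes "\<And>c. module_hom sA sA (\<lambda>b. h b c)" "\<And>b. module_hom sC sA (h b)"
  shows "entwine_sum c 1 h = h 1 c"
  unfolding entwine_sum_def entwine_one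
  by (simp add: tens2_def sweedler_coset2 vector_space_algebra assms fsum_sweedler)

section \<open>The action and the convolution, and their linearity\<close>

definition act :: "'a \<Rightarrow> ('c \<Rightarrow> 'a) \<Rightarrow> 'c \<Rightarrow> 'a"
  where "act a G c = entwine_sum c a (\<lambda>b c'. b * G c')"

definition conv :: "('c \<Rightarrow> 'a) \<Rightarrow> ('c \<Rightarrow> 'a) \<Rightarrow> 'c \<Rightarrow> 'a"
  where "conv F G c = comult_sum c (\<lambda>c1 c2. act (F c2) G c1)"

lemma act_hom:
  assumes "module_hom sC sA G"
  shows "module_hom sC sA (act a G)" "module_hom sA sA (\<lambda>a. act a G c)"
  unfolding act_def
  by (rule entwine_sum_hom; intro module_hom_mult module_hom_times assms)+

lemma act_arg_hom:
  assumes "module_hom sC sA G" "module_hom q sA L"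
  shows "module_hom q sA (\<lambda>x. act (L x) G c)"
  by (rule module_hom_comp[OF act_hom(2)[OF assms(1)] assms(2)])

lemma act_body_hom:
  assumes "vector_space q" "\<And>c. module_hom q sA (\<lambda>x. G x c)"
  shows "module_hom q sA (\<lambda>x. act a (G x) c)"
  unfolding act_def
  by (intro entwine_sum_body_hom module_hom_times assms)

lemma conv_hom:
  assumes "module_hom sC sA F" "module_hom sC sA G"
  shows "module_hom sC sA (conv F G)"
  unfolding conv_def
  by (intro comult_sum_hom act_arg_hom act_hom assms)

text \<open>\<open>F x\<close> enters inside the tensor that gets entwined, so linearity in
  \<open>x\<close> rests on linearity of the action in its algebra argument, and this comes from
  linearity of \<open>G\<close>. For the right factor, in \<open>conv_right_hom\<close>, only the
  summands vary.\<close>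

lemma conv_left_hom:
  assumes "vector_space q" "\<And>c. module_hom q sA (\<lambda>x. F x c)" "module_hom sC sA G"
  shows "module_hom q sA (\<lambda>x. conv (F x) G c)"
  unfolding conv_def
  by (intro comult_sum_body_hom act_arg_hom assms)

lemma conv_right_hom:
  assumes "vector_space q" "\<And>c. module_hom q sA (\<lambda>x. G x c)"
  shows "module_hom q sA (\<lambda>x. conv F (G x) c)"
  unfolding conv_def
  by (intro comult_sum_body_hom act_body_hom assms)

text \<open>With all functions from C to A as the parameter space, the linearity lemmas can be
  applied with the factor of a convolution itself as the parameter.\<close>

lemma function_eval_hom: "module_hom (\<lambda>r (F :: 'c \<Rightarrow> 'a) c. sA r (F c)) sA (\<lambda>F. F c)"
  and vector_space_function: "vector_space (\<lambda>r (F :: 'c \<Rightarrow> 'a) c. sA r (F c))"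
proof -
  show vs: "vector_space (\<lambda>r (F :: 'c \<Rightarrow> 'a) c. sA r (F c))"
    by unfold_locales (auto simp: fun_eq_iff A.scale_right_distrib A.scale_left_distrib)
  show "module_hom (\<lambda>r (F :: 'c \<Rightarrow> 'a) c. sA r (F c)) sA (\<lambda>F. F c)"
    by (rule module_homI[OF vs vector_space_algebra]) auto
qed

lemma conv_linear_left:
  assumes G: "module_hom sC sA G"
  shows "conv (\<lambda>c. F c + F' c) G c = conv F G c + conv F' G c"
    and "conv (\<lambda>c. sA r (F c)) G c = sA r (conv F G c)"
    and "conv (\<lambda>c. \<Sum>i\<in>I. K i c) G c = (\<Sum>i\<in>I. conv (K i) G c)"
proof -
  have hom: "module_hom (\<lambda>r F c. sA r (F c)) sA (\<lambda>F. conv F G c)" for c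
    by (rule conv_left_hom[OF vector_space_function function_eval_hom G])
  show add: "conv (\<lambda>c. F c + F' c) G c = conv F G c + conv F' G c" for F F'
    using module_hom.add[OF hom, of F F'] by (simp add: plus_fun_def)
  show "conv (\<lambda>c. sA r (F c)) G c = sA r (conv F G c)"
    by (rule module_hom.scale[OF hom])
  have "conv (\<lambda>c. 0) G c = 0"
    using module_hom.zero[OF hom] by (simp add: zero_fun_def)
  then show "conv (\<lambda>c. \<Sum>i\<in>I. K i c) G c = (\<Sum>i\<in>I. conv (K i) G c)"
    by (induction I rule: infinite_finite_induct) (simp_all add: add)
qed

lemma conv_linear_right:
  shows "conv F (\<lambda>c. G c + G' c) c = conv F G c + conv F G' c"
    and "conv F (\<lambda>c. sA r (G c)) c = sA r (conv F G c)"
    and "conv F (\<lambda>c. \<Sum>i\<in>I. K i c) c = (\<Sum>i\<in>I. conv F (K i) c)"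
proof -
  have hom: "module_hom (\<lambda>r G c. sA r (G c)) sA (\<lambda>G. conv F G c)" for c
    by (rule conv_right_hom[OF vector_space_function function_eval_hom])
  show add: "conv F (\<lambda>c. G c + G' c) c = conv F G c + conv F G' c" for G G'
    using module_hom.add[OF hom, of G G'] by (simp add: plus_fun_def)
  show "conv F (\<lambda>c. sA r (G c)) c = sA r (conv F G c)"
    by (rule module_hom.scale[OF hom])
  have "conv F (\<lambda>c. 0) c = 0"
    using module_hom.zero[OF hom] by (simp add: zero_fun_def)
  then show "conv F (\<lambda>c. \<Sum>i\<in>I. K i c) c = (\<Sum>i\<in>I. conv F (K i) c)"
    by (induction I rule: infinite_finite_induct) (simp_all add: add)
qed

section \<open>Algebraic laws of action and convolution\<close>

lemma act_mult:
  assumes "module_hom sC sA G"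
  shows "act (a * b) G c = act a (act b G) c"
  unfolding act_def
  by (subst entwine_mult_sum)
    (auto intro!: module_hom_mult module_hom_times assms simp: hom_entwine_sum mult.assoc
      module_hom_mult)

lemma act_conv:
  assumes F: "module_hom sC sA F" and G: "module_hom sC sA G"
  shows "act a (conv F G) c = conv (act a F) G c"
proof -
  have "act a (conv F G) c =
      entwine_sum c a (\<lambda>b c'. comult_sum c' (\<lambda>c1 c2. b * act (F c2) G c1))"
    by (simp add: act_def[of a] conv_def hom_comult_sum[OF module_hom_mult(2)])
  \<comment> \<open>Compatibility with the coproduct entwines \<open>a\<close> with
    \<open>c2\<close> first and the result with \<open>c1\<close>; the second entwining is again an
    action, that of \<open>b\<close>.\<close>
  also have "\<dots> = comult_sum c (\<lambda>c1 c2. entwine_sum c2 a (\<lambda>b c2'. act b (act (F c2') G) c1))"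
    by (subst entwine_comult_sum)
      (auto simp: act_def[where G = "act _ _"] intro!: module_hom_mult module_hom_times act_arg_hom act_hom F G)
  \<comment> \<open>The two actions combine into that of \<open>b * F c2'\<close>, and linearity of
    the action in its algebra argument pulls the sum over \<open>b\<close> and \<open>c2'\<close>
    inside, where it is \<open>act a F c2\<close>.\<close>
  also have "\<dots> = comult_sum c (\<lambda>c1 c2. act (act a F c2) G c1)"
    by (simp add: act_mult[OF G, symmetric] act_def[of a F]
        hom_entwine_sum[OF act_hom(2)[OF G]])
  finally show ?thesis
    by (simp add: conv_def)
qed

lemma conv_assoc:
  assumes F: "module_hom sC sA F" and G: "module_hom sC sA G" and H: "module_hom sC sA H"
  shows "conv (conv F G) H c = conv F (conv G H) c"
proof -
  have "conv F (conv G H) c =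
      comult_sum c (\<lambda>c1 c2. comult_sum c1 (\<lambda>c11 c12. act (act (F c2) G c12) H c11))"
    \<comment> \<open>The outer convolution is unfolded first, so that \<open>act_conv\<close> meets
      the inner one while it is still intact.\<close>
    by (simp add: conv_def[of F] act_conv[OF G H]) (simp add: conv_def)
  also have "\<dots> = comult_sum c (\<lambda>c1 c2. comult_sum c2 (\<lambda>c21 c22. act (act (F c22) G c21) H c1))"
    by (rule coassoc_sum) (intro act_arg_hom act_hom F G H)+
  also have "\<dots> = conv (conv F G) H c"
    by (simp add: conv_def hom_comult_sum[OF act_hom(2)[OF H]])
  finally show ?thesis ..
qed

text \<open>This holds summand by summand: acting by \<open>a\<close> and then by
  \<open>F c2\<close> is acting by \<open>F c2 * a\<close>.\<close>

lemma conv_act: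
  assumes "module_hom sC sA G"
  shows "conv F (act a G) c = conv (\<lambda>c. F c * a) G c"
  by (simp add: conv_def act_mult assms)

lemma act_mult_right: "act a (\<lambda>c. G c * b) c = act a G c * b"
  unfolding act_def by (subst hom_entwine_sum[OF module_hom_mult(1)]) (simp add: mult.assoc)

lemma conv_mult_right: "conv F (\<lambda>c. G c * b) c = conv F G c * b"
  unfolding conv_def by (subst hom_comult_sum[OF module_hom_mult(1)]) (simp add: act_mult_right)

section \<open>The unit of the convolution\<close>

definition unit_map :: "'c \<Rightarrow> 'a"
  where "unit_map c = sA (\<epsilon> c) 1"

lemma unit_map_hom: "module_hom sC sA unit_map"
  using counit_linear
  by (auto intro!: module_homI[OF vector_space_coalgebra vector_space_algebra]
      simp: unit_map_def lin_map_def A.scale_left_distrib)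

lemma act_one:
  assumes "module_hom sC sA G"
  shows "act 1 G c = G c"
  unfolding act_def
  by (subst entwine_one_sum) (auto intro!: module_hom_mult module_hom_times assms)

text \<open>The left factor is evaluated at the second leg of the coproduct, so the left unit law
  comes from the right counit law, and conversely in \<open>conv_unit_right\<close>.\<close>

lemma conv_unit_left:
  assumes G: "module_hom sC sA G"
  shows "conv unit_map G c = G c"
proof -
  have "conv unit_map G c = comult_sum c (\<lambda>c1 c2. G (sC (\<epsilon> c2) c1))"
    by (simp add: conv_def unit_map_def module_hom.scale[OF act_hom(2)[OF G]] act_one[OF G]
        module_hom.scale[OF G])
  also have "\<dots> = G (sweedler sC (\<Delta> c) (\<lambda>(c1, c2). sC (\<epsilon> c2) c1))"
    by (simp add: module_hom_sweedler[OF G] comult_sum_def case_prod_unfold)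
  finally show ?thesis
    by (simp add: counit_right)
qed

lemma conv_unit_right:
  assumes F: "module_hom sC sA F"
  shows "conv F unit_map c = F c"
proof -
  \<comment> \<open>The counit axiom of the entwining map, read as a statement about the
    action.\<close>
  have "act a unit_map c = sA (\<epsilon> c) a" for a c
    using entwine_counit[of c a]
    by (simp add: act_def unit_map_def scale_mult entwine_sum_def)
  then have "conv F unit_map c = comult_sum c (\<lambda>c1 c2. F (sC (\<epsilon> c1) c2))"
    by (simp add: conv_def module_hom.scale[OF F])
  also have "\<dots> = F (sweedler sC (\<Delta> c) (\<lambda>(c1, c2). sC (\<epsilon> c1) c2))"
    by (simp add: module_hom_sweedler[OF F] comult_sum_def case_prod_unfold)
  finally show ?thesis
    by (simp add: counit_left)
qed

end

section \<open>Cochains as multilinear functions\<close>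

lemma spacen_add: "X \<in> spacen s t n \<Longrightarrow> Y \<in> spacen s t n \<Longrightarrow> X + Y \<in> spacen s t n"
  unfolding spacen_def relsn_def
  by (force simp: coset_add dest!: subsetD[OF Poly_Mapping.keys_add])

lemma spacen_scale: "X \<in> spacen s t n \<Longrightarrow> qscale (relsn s t n) r X \<in> spacen s t n"
  unfolding spacen_def relsn_def
  by (fastforce simp: qscale_coset in_keys_iff lookup_fscale)

lemma spacen_zero: "0 +o relsn s t n \<in> spacen s t n"
  unfolding spacen_def by (intro CollectI exI[of _ 0]) simp

context entwining
begin

section \<open>Cochains and their values on pure tensors\<close>

definition multilinear :: "nat \<Rightarrow> ('c \<times> 'a list \<Rightarrow> 'a) \<Rightarrow> bool"
  where "multilinear n h \<longleftrightarrow>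
    (\<forall>as. length as = n \<longrightarrow> module_hom sC sA (\<lambda>c. h (c, as))) \<and>
    (\<forall>c as i. length as = n \<longrightarrow> i < n \<longrightarrow> module_hom sA sA (\<lambda>a. h (c, as[i := a])))"

definition cvalue :: "('k, 'c, 'a) cochain \<Rightarrow> 'a list \<Rightarrow> 'c \<Rightarrow> 'a"
  where "cvalue f as c = f (tensn sC sA c as)"

definition cscale :: "'k \<Rightarrow> ('k, 'c, 'a) cochain \<Rightarrow> ('k, 'c, 'a) cochain"
  where "cscale r f = (\<lambda>X. sA r (f X))"

lemma vector_space_cscale: "vector_space cscale"
  by unfold_locales
    (auto simp: cscale_def fun_eq_iff A.scale_right_distrib A.scale_left_distrib)

lemma cvalue_hom: "module_hom cscale sA (\<lambda>f. cvalue f as c)"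
  by (rule module_homI[OF vector_space_cscale vector_space_algebra])
    (auto simp: cvalue_def cscale_def)

lemma cochain_coset:
  assumes f: "f \<in> cochains sA sC n" and x: "\<forall>p\<in>Poly_Mapping.keys x. length (snd p) = n"
  shows "f (x +o relsn sC sA n) = fsum sA (\<lambda>(c, as). cvalue f as c) x"
proof -
  let ?N = "relsn sC sA n"
  let ?x = "\<lambda>p. fscale (Poly_Mapping.lookup x p) (gen p)"
  have add: "f (X + Y) = f X + f Y" and scale: "f (qscale ?N r X) = sA r (f X)"
    if "X \<in> spacen sC sA n" "Y \<in> spacen sC sA n" for X Y r
    using f that by (auto simp: cochains_def lin_map_def)
  \<comment> \<open>Additivity of \<open>f\<close> is available only on \<open>spacen\<close>, so
    the induction carries membership of the partial sums along.\<close>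
  have "sum ?x P +o ?N \<in> spacen sC sA n \<and>
      f (sum ?x P +o ?N) = (\<Sum>(c, as)\<in>P. sA (Poly_Mapping.lookup x (c, as)) (cvalue f as c))"
    if "finite P" "P \<subseteq> Poly_Mapping.keys x" for P
    using that
  proof (induction P rule: finite_induct)
    case empty
    \<comment> \<open>The zero coset is 0 times itself, so homogeneity makes \<open>f\<close> vanish
      there.\<close>
    have "0 +o ?N = qscale ?N 0 (0 +o ?N)"
      unfolding relsn_def by (subst qscale_coset) simp
    then show ?case
      using scale[OF spacen_zero spacen_zero, of 0] spacen_zero by simp
  next
    case (insert p P)
    obtain c as where p: "p = (c, as)"
      by fastforce
    with insert x have "length as = n"
      by auto
    then have T: "tensn sC sA c as = gen p +o ?N" "tensn sC sA c as \<in> spacen sC sA n"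
      using tensn_in_spacen[of as n sC sA c] by (simp_all add: tensn_def p)
    have "sum ?x (insert p P) +o ?N = (?x p +o ?N) + (sum ?x P +o ?N)"
      using insert by (simp add: relsn_def coset_add)
    also have "?x p +o ?N = qscale ?N (Poly_Mapping.lookup x p) (tensn sC sA c as)"
      by (simp add: T relsn_def qscale_coset)
    finally show ?case
      using insert T spacen_scale[OF T(2)] by (simp add: add scale spacen_add p cvalue_def)
  qed
  from this[OF finite_keys subset_refl] show ?thesis
    by (simp add: poly_mapping_expand[symmetric] fsum_def case_prod_unfold)
qed

text \<open>Pure tensors span the tensor product, and outside it both functions are 0. Identities of
  cochains are thereby reduced to identities of linear maps from C to A.\<close>

lemma cochain_eqI:
  assumes "f \<in> cochains sA sC n" "g \<in> cochains sA sC n"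
    and "\<And>as c. length as = n \<Longrightarrow> cvalue f as c = cvalue g as c"
  shows "f = g"
proof
  fix X
  show "f X = g X"
  proof (cases "X \<in> spacen sC sA n")
    case True
    then obtain x where x: "X = x +o relsn sC sA n" "\<forall>p\<in>Poly_Mapping.keys x. length (snd p) = n"
      by (auto simp: spacen_def)
    then show ?thesis
      by (simp add: cochain_coset[OF assms(1)] cochain_coset[OF assms(2)])
        (auto simp: fsum_def assms(3) intro!: sum.cong)
  next
    case False
    then show ?thesis
      using assms by (simp add: cochains_def)
  qed
qed

lemma cvalue_hom_coalgebra:
  assumes "f \<in> cochains sA sC n" "length as = n"
  shows "module_hom sC sA (cvalue f as)"
  using assms
  by (intro module_homI[OF vector_space_coalgebra vector_space_algebra])
    (auto simp: cvalue_def cochains_def lin_map_def tensn_linear tensn_in_spacen)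

lemma cvalue_hom_slot:
  assumes "f \<in> cochains sA sC n" "length as = n" "i < n"
  shows "module_hom sA sA (\<lambda>a. cvalue f (as[i := a]) c)"
  using assms
  by (intro module_homI[OF vector_space_algebra vector_space_algebra])
    (auto simp: cvalue_def cochains_def lin_map_def tensn_linear tensn_in_spacen)

lemma sweedler_multilinear:
  assumes "multilinear n h"
  shows "sweedler sA (x +o relsn sC sA n) h = fsum sA h x"
  unfolding relsn_def
  by (rule sweedler_coset[OF vector_space_algebra])
    (use assms in \<open>auto simp: multilinear_def elim!: fsum_slot_rels intro: vector_space_algebra\<close>)

text \<open>The existence half of the universal property: multilinearity makes the sum independent
  of the representative, and on representatives it is the linear map \<open>fsum\<close>.\<close>

lemma cochain_of_cochains:
  assumes h: "multilinear n h"
  shows "cochain_of sA sC n h \<in> cochains sA sC n"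
proof -
  interpret f: module_hom fscale sA "fsum sA h"
    by (rule module_hom_fsum[OF vector_space_algebra])
  note eq = sweedler_multilinear[OF h]
  have "sweedler sA (X + Y) h = sweedler sA X h + sweedler sA Y h"
    and "sweedler sA (qscale (relsn sC sA n) r X) h = sA r (sweedler sA X h)"
    if XY: "X \<in> spacen sC sA n" "Y \<in> spacen sC sA n" for X Y r
  proof -
    obtain x y where "X = x +o relsn sC sA n" "Y = y +o relsn sC sA n"
      using XY by (auto simp: spacen_def)
    then show "sweedler sA (X + Y) h = sweedler sA X h + sweedler sA Y h"
      "sweedler sA (qscale (relsn sC sA n) r X) h = sA r (sweedler sA X h)"
      using eq[of "x + y"] eq[of "fscale r x"] eq[of x] eq[of y]
      by (simp_all add: relsn_def coset_add qscale_coset f.add f.scale)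
  qed
  then show ?thesis
    by (auto simp: cochains_def cochain_of_def lin_map_def spacen_add spacen_scale)
qed

lemma cvalue_cochain_of:
  assumes "multilinear n h" "length as = n"
  shows "cvalue (cochain_of sA sC n h) as c = h (c, as)"
  using assms tensn_in_spacen[OF assms(2), of sC sA c] sweedler_multilinear[OF assms(1), of "gen (c, as)"]
  by (simp add: cvalue_def cochain_of_def tensn_def fsum_gen[OF vector_space_algebra])

section \<open>Closure of cochains under linear operations\<close>

lemma cochains_zero: "0 \<in> cochains sA sC n"
  by (auto simp: cochains_def lin_map_def)

lemma cochains_add: "f \<in> cochains sA sC n \<Longrightarrow> g \<in> cochains sA sC n \<Longrightarrow> f + g \<in> cochains sA sC n"
  by (auto simp: cochains_def lin_map_def A.scale_right_distrib algebra_simps)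

lemma cochains_scale: "f \<in> cochains sA sC n \<Longrightarrow> cscale r f \<in> cochains sA sC n"
  by (auto simp: cochains_def lin_map_def A.scale_right_distrib cscale_def mult.commute)

lemma cochains_sum:
  "(\<And>i. i \<in> I \<Longrightarrow> f i \<in> cochains sA sC n) \<Longrightarrow> sum f I \<in> cochains sA sC n"
  by (induction I rule: infinite_finite_induct) (auto intro: cochains_zero cochains_add)

section \<open>The cup product\<close>

lemma cup_val_conv:
  "cup_val sA sC \<Delta> \<psi> m f g (c, as) = conv (cvalue f (take m as)) (cvalue g (drop m as)) c"
  by (simp add: cup_val_def conv_def act_def[abs_def] cvalue_def[abs_def] comult_sum_def entwine_sum_def)

lemma multilinear_cup_val:
  assumes f: "f \<in> cochains sA sC m" and g: "g \<in> cochains sA sC n"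
  shows "multilinear (m + n) (cup_val sA sC \<Delta> \<psi> m f g)"
  unfolding multilinear_def cup_val_conv
proof (intro conjI allI impI)
  fix as :: "'a list" assume len: "length as = m + n"
  note F = cvalue_hom_coalgebra[OF f] and G = cvalue_hom_coalgebra[OF g]
  show "module_hom sC sA (\<lambda>c. conv (cvalue f (take m as)) (cvalue g (drop m as)) c)"
    using len by (intro conv_hom F G) auto
  fix c i assume i: "i < m + n"
  show "module_hom sA sA (\<lambda>a. conv (cvalue f (take m (as[i := a]))) (cvalue g (drop m (as[i := a]))) c)"
  \<comment> \<open>The changed slot lies in exactly one of the two parts of the list; in the second
    part its index drops by \<open>m\<close>.\<close>
  proof (cases "i < m")
    case True
    then show ?thesis
      using len by (simp add: take_update_swap drop_update_cancel)
        (intro conv_left_hom cvalue_hom_slot[OF f] G vector_space_algebra; simp)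
  next
    case False
    then show ?thesis
      using len i by (simp add: drop_update_swap)
        (intro conv_right_hom cvalue_hom_slot[OF g] vector_space_algebra; simp)
  qed
qed

abbreviation cupc where "cupc \<equiv> cup sA sC \<Delta> \<psi>"

lemma cup_cochains:
  "f \<in> cochains sA sC m \<Longrightarrow> g \<in> cochains sA sC n \<Longrightarrow> cupc m n f g \<in> cochains sA sC (m + n)"
  unfolding cup_def by (rule cochain_of_cochains[OF multilinear_cup_val])

lemma cvalue_cup:
  assumes "f \<in> cochains sA sC m" "g \<in> cochains sA sC n" "length as = m + n"
  shows "cvalue (cupc m n f g) as c = conv (cvalue f (take m as)) (cvalue g (drop m as)) c"
  unfolding cup_def using cvalue_cochain_of[OF multilinear_cup_val] assms
  by (simp add: cup_val_conv)

lemma cup_assoc: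
  assumes f: "f \<in> cochains sA sC m" and g: "g \<in> cochains sA sC n" and h: "h \<in> cochains sA sC p"
  shows "cupc (m + n) p (cupc m n f g) h = cupc m (n + p) f (cupc n p g h)"
proof (rule cochain_eqI[where n = "m + n + p"])
  note fg = cup_cochains[OF f g] and gh = cup_cochains[OF g h]
  show "cupc (m + n) p (cupc m n f g) h \<in> cochains sA sC (m + n + p)"
    using cup_cochains[OF fg h] .
  show "cupc m (n + p) f (cupc n p g h) \<in> cochains sA sC (m + n + p)"
    using cup_cochains[OF f gh] by (simp add: add.assoc)
  fix as :: "'a list" and c
  assume len: "length as = m + n + p"
  let ?F = "cvalue f (take m as)" and ?G = "cvalue g (take n (drop m as))"
  let ?H = "cvalue h (drop (m + n) as)"
  have "cvalue (cupc m n f g) (take (m + n) as) = conv ?F ?G"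
    using len by (auto simp: cvalue_cup[OF f g] drop_take min_def)
  moreover have "cvalue (cupc n p g h) (drop m as) = conv ?G ?H"
    using len by (auto simp: cvalue_cup[OF g h] add.commute)
  moreover have "conv (conv ?F ?G) ?H c = conv ?F (conv ?G ?H) c"
    using len by (intro conv_assoc cvalue_hom_coalgebra[OF f] cvalue_hom_coalgebra[OF g]
        cvalue_hom_coalgebra[OF h]) auto
  ultimately show "cvalue (cupc (m + n) p (cupc m n f g) h) as c =
      cvalue (cupc m (n + p) f (cupc n p g h)) as c"
    using len by (simp add: cvalue_cup[OF fg h] cvalue_cup[OF f gh])
qed

section \<open>The unit cochain\<close>

definition unit_cochain :: "('k, 'c, 'a) cochain"
  where "unit_cochain = cochain_of sA sC 0 (\<lambda>(c, as). unit_map c)"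

lemma multilinear_unit: "multilinear 0 (\<lambda>(c, as). unit_map c)"
  by (simp add: multilinear_def unit_map_hom)

lemma unit_cochain: "unit_cochain \<in> cochains sA sC 0"
  unfolding unit_cochain_def by (rule cochain_of_cochains[OF multilinear_unit])

lemma cvalue_unit_cochain: "cvalue unit_cochain [] = unit_map"
  by (auto simp: unit_cochain_def cvalue_cochain_of[OF multilinear_unit])

lemma cup_unit_left:
  assumes f: "f \<in> cochains sA sC n"
  shows "cupc 0 n unit_cochain f = f"
  using cup_cochains[OF unit_cochain f]
  by (intro cochain_eqI[OF _ f])
    (simp_all add: cvalue_cup[OF unit_cochain f] cvalue_unit_cochain conv_unit_left cvalue_hom_coalgebra[OF f])

lemma cup_unit_right:
  assumes f: "f \<in> cochains sA sC n"
  shows "cupc n 0 f unit_cochain = f"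
  using cup_cochains[OF f unit_cochain]
  by (intro cochain_eqI[OF _ f])
    (simp_all add: cvalue_cup[OF f unit_cochain] cvalue_unit_cochain conv_unit_right cvalue_hom_coalgebra[OF f])

text \<open>Additivity, homogeneity and compatibility with finite sums of the cup product are all
  read off from this single linearity statement on values.\<close>

lemma cvalue_cup_hom:
  assumes "length as = m + n"
  shows "g \<in> cochains sA sC n \<Longrightarrow>
      module_hom cscale sA (\<lambda>f. conv (cvalue f (take m as)) (cvalue g (drop m as)) c)"
    and "module_hom cscale sA (\<lambda>g. conv (cvalue f (take m as)) (cvalue g (drop m as)) c)"
  using assms
  by (intro conv_left_hom conv_right_hom vector_space_cscale cvalue_hom cvalue_hom_coalgebra; simp)+

lemma cup_sum_left:
  assumes f: "\<And>i. i \<in> I \<Longrightarrow> f i \<in> cochains sA sC m" and g: "g \<in> cochains sA sC n"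
  shows "cupc m n (\<Sum>i\<in>I. f i) g = (\<Sum>i\<in>I. cupc m n (f i) g)"
  using f
  by (intro cochain_eqI[where n = "m + n"] cup_cochains cochains_sum g)
    (simp_all add: cvalue_cup cochains_sum g module_hom.sum[OF cvalue_hom]
      module_hom.sum[OF cvalue_cup_hom(1)[OF _ g]])

lemma cup_sum_right:
  assumes f: "f \<in> cochains sA sC m" and g: "\<And>i. i \<in> I \<Longrightarrow> g i \<in> cochains sA sC n"
  shows "cupc m n f (\<Sum>i\<in>I. g i) = (\<Sum>i\<in>I. cupc m n f (g i))"
  using g
  by (intro cochain_eqI[where n = "m + n"] cup_cochains cochains_sum f)
    (simp_all add: cvalue_cup cochains_sum f module_hom.sum[OF cvalue_hom]
      module_hom.sum[OF cvalue_cup_hom(2)])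

lemma cup_add_left:
  assumes "f \<in> cochains sA sC m" "f' \<in> cochains sA sC m" and g: "g \<in> cochains sA sC n"
  shows "cupc m n (f + f') g = cupc m n f g + cupc m n f' g"
  using assms
  by (intro cochain_eqI[where n = "m + n"] cup_cochains cochains_add)
    (simp_all add: cvalue_cup cochains_add module_hom.add[OF cvalue_hom]
      module_hom.add[OF cvalue_cup_hom(1)[OF _ g]])

lemma cup_add_right:
  assumes "f \<in> cochains sA sC m" "g \<in> cochains sA sC n" "g' \<in> cochains sA sC n"
  shows "cupc m n f (g + g') = cupc m n f g + cupc m n f g'"
  using assms
  by (intro cochain_eqI[where n = "m + n"] cup_cochains cochains_add)
    (simp_all add: cvalue_cup cochains_add module_hom.add[OF cvalue_hom]
      module_hom.add[OF cvalue_cup_hom(2)])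

lemma cup_scale_left:
  assumes "f \<in> cochains sA sC m" and g: "g \<in> cochains sA sC n"
  shows "cupc m n (cscale r f) g = cscale r (cupc m n f g)"
  using assms
  by (intro cochain_eqI[where n = "m + n"] cup_cochains cochains_scale)
    (simp_all add: cvalue_cup cochains_scale module_hom.scale[OF cvalue_hom]
      module_hom.scale[OF cvalue_cup_hom(1)[OF _ g]])

lemma cup_scale_right:
  assumes "f \<in> cochains sA sC m" "g \<in> cochains sA sC n"
  shows "cupc m n f (cscale r g) = cscale r (cupc m n f g)"
  using assms
  by (intro cochain_eqI[where n = "m + n"] cup_cochains cochains_scale)
    (simp_all add: cvalue_cup cochains_scale module_hom.scale[OF cvalue_hom]
      module_hom.scale[OF cvalue_cup_hom(2)])

lemma cup_zero_left: "g \<in> cochains sA sC n \<Longrightarrow> cupc m n 0 g = 0"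
  using cup_sum_left[of "{}" undefined m g n] by simp

lemma cup_zero_right: "f \<in> cochains sA sC m \<Longrightarrow> cupc m n f 0 = 0"
  using cup_sum_right[of f m "{}" undefined n] by simp

end

section \<open>The coboundary\<close>

text \<open>The number \<open>i\<close> counts from 1 as in the coboundary formula, while list
  positions count from 0: the i-th and (i+1)-st arguments sit at \<open>i - 1\<close> and
  \<open>i\<close>.\<close>

definition merge :: "nat \<Rightarrow> 'a::times list \<Rightarrow> 'a list"
  where "merge i as = take (i - 1) as @ [as ! (i - 1) * as ! i] @ drop (i + 1) as"

lemma length_merge: "1 \<le> i \<Longrightarrow> i < length as \<Longrightarrow> length (merge i as) = length as - 1"
  by (simp add: merge_def)

text \<open>An entrywise description, which turns the list identities below into comparisons of
  indices.\<close>

lemma nth_merge: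
  assumes "1 \<le> i" "i < length as" "k < length as - 1"
  shows "merge i as ! k =
    (if k + 1 < i then as ! k else if k + 1 = i then as ! k * as ! i else as ! (k + 1))"
proof -
  have "length (take (i - 1) as) = i - 1"
    using assms by simp
  moreover have "k - (i - 1) = Suc (k - i)" "i + 1 + (k - i) = k + 1" if "i \<le> k"
    using assms that by auto
  ultimately show ?thesis
    using assms by (auto simp: merge_def nth_append not_less)
qed

text \<open>The cases are: before the merged pair, its left factor, its right factor, and after the
  pair. From the right factor on, positions drop by one.\<close>

lemma merge_update:
  assumes "1 \<le> i" "i < length as" "j < length as"
  shows "merge i (as[j := a]) =
    (if j + 1 < i then (merge i as)[j := a]
     else if j + 1 = i then (merge i as)[j := a * as ! i]
     else if j = i then (merge i as)[j - 1 := as ! (j - 1) * a]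
     else (merge i as)[j - 1 := a])"
  using assms by (intro nth_equalityI) (auto simp: length_merge nth_merge nth_list_update)

text \<open>Since \<open>i \<le> m\<close>, both multiplied entries lie among the first
  \<open>m + 1\<close>. In \<open>merge_split_right\<close> both lie at position \<open>m\<close> or
  later, so each product belongs to one factor of the cup product.\<close>

lemma merge_split_left:
  assumes "1 \<le> i" "i \<le> m" "m < length as"
  shows "take m (merge i as) = merge i (take (m + 1) as)" "drop m (merge i as) = drop (m + 1) as"
  using assms by (auto intro!: nth_equalityI simp: length_merge nth_merge)

lemma merge_split_right:
  assumes "1 \<le> i" "m + i < length as"
  shows "take m (merge (m + i) as) = take m as" "drop m (merge (m + i) as) = merge i (drop m as)"
  using assms by (auto intro!: nth_equalityI simp: length_merge nth_merge)

context entwining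
begin

section \<open>The coboundary of a cochain\<close>

lemma cobd_val_act:
  "cobd_val sA sC \<psi> n f (c, as) = act (as ! 0) (cvalue f (drop 1 as)) c +
    (\<Sum>i = 1..n. sA ((-1) ^ i) (cvalue f (merge i as) c)) +
    sA ((-1) ^ (n + 1)) (cvalue f (take n as) c * as ! n)"
  by (simp add: cobd_val_def act_def cvalue_def[abs_def] entwine_sum_def merge_def)

text \<open>The variable enters one slot of the merged list, either bare or multiplied by a fixed
  neighbour; multiplication on either side is linear.\<close>

lemma merge_slot_hom:
  assumes f: "f \<in> cochains sA sC n" and len: "length as = n + 1" and "1 \<le> i" "i \<le> n" "j \<le> n"
  shows "module_hom sA sA (\<lambda>a. cvalue f (merge i (as[j := a])) c)"
proof -
  have L: "length (merge i as) = n"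
    using assms by (simp add: length_merge)
  note slot = cvalue_hom_slot[OF f L]
  have slot_mult: "module_hom sA sA (\<lambda>a. cvalue f ((merge i as)[k := a * y]) c)"
    "module_hom sA sA (\<lambda>a. cvalue f ((merge i as)[k := y * a]) c)" if "k < n" for k y
    using module_hom_comp[OF slot[OF that] module_hom_mult(1)]
      module_hom_comp[OF slot[OF that] module_hom_mult(2)] .
  consider "j + 1 < i" | "j + 1 = i" | "j = i" | "i < j"
    by linarith
  then show ?thesis
    by cases (use assms slot slot_mult in \<open>auto simp: merge_update\<close>)
qed

lemma multilinear_cobd_val:
  assumes f: "f \<in> cochains sA sC n"
  shows "multilinear (n + 1) (cobd_val sA sC \<psi> n f)"
  unfolding multilinear_def cobd_val_act
proof (intro conjI allI impI)
  fix as :: "'a list" assume len: "length as = n + 1"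
  note F = cvalue_hom_coalgebra[OF f]
  show "module_hom sC sA (\<lambda>c. act (as ! 0) (cvalue f (drop 1 as)) c +
    (\<Sum>i = 1..n. sA ((-1) ^ i) (cvalue f (merge i as) c)) +
    sA ((-1) ^ (n + 1)) (cvalue f (take n as) c * as ! n))"
    using len by (intro module_hom_plus module_hom_sum module_hom_scaled module_hom_times act_hom F
        vector_space_algebra vector_space_coalgebra) (auto simp: length_merge)
  fix c j assume j: "j < n + 1"
  have "module_hom sA sA (\<lambda>a. act (as[j := a] ! 0) (cvalue f (drop 1 (as[j := a]))) c)"
  \<comment> \<open>The first argument is the acting element; every later one lies in
    \<open>drop 1 as\<close>, at a position lower by one.\<close>
  proof (cases j)
    case 0
    then show ?thesis
      using len by (cases as) (auto intro!: act_hom F)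
  next
    case (Suc k)
    then show ?thesis
      using len j by (cases as) (auto intro!: act_body_hom cvalue_hom_slot[OF f] vector_space_algebra)
  qed
  moreover have "module_hom sA sA (\<lambda>a. cvalue f (take n (as[j := a])) c * as[j := a] ! n)"
  \<comment> \<open>The last argument is the right factor; all others are arguments of
    \<open>f\<close>.\<close>
  proof (cases "j = n")
    case True
    then show ?thesis
      using len by (simp add: module_hom_mult)
  next
    case False
    then show ?thesis
      using len j by (simp add: take_update_swap)
        (intro module_hom_times cvalue_hom_slot[OF f]; simp)
  qed
  ultimately show "module_hom sA sA (\<lambda>a. act (as[j := a] ! 0) (cvalue f (drop 1 (as[j := a]))) c +
    (\<Sum>i = 1..n. sA ((-1) ^ i) (cvalue f (merge i (as[j := a])) c)) +
    sA ((-1) ^ (n + 1)) (cvalue f (take n (as[j := a])) c * as[j := a] ! n))"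
    using len j by (intro module_hom_plus module_hom_sum module_hom_scaled merge_slot_hom[OF f]
        vector_space_algebra) auto
qed

abbreviation cobdc where "cobdc \<equiv> cobd sA sC \<psi>"

lemma cobd_cochains: "f \<in> cochains sA sC n \<Longrightarrow> cobdc n f \<in> cochains sA sC (n + 1)"
  unfolding cobd_def by (rule cochain_of_cochains[OF multilinear_cobd_val])

lemma cvalue_cobd:
  assumes "f \<in> cochains sA sC n" "length as = n + 1"
  shows "cvalue (cobdc n f) as c = act (as ! 0) (cvalue f (drop 1 as)) c +
    (\<Sum>i = 1..n. sA ((-1) ^ i) (cvalue f (merge i as) c)) +
    sA ((-1) ^ (n + 1)) (cvalue f (take n as) c * as ! n)"
  using cvalue_cochain_of[OF multilinear_cobd_val] assms by (simp add: cobd_def cobd_val_act)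

lemma cvalue_cobd_hom:
  "module_hom cscale sA (\<lambda>f. act (as ! 0) (cvalue f (drop 1 as)) c +
    (\<Sum>i = 1..n. sA ((-1) ^ i) (cvalue f (merge i as) c)) +
    sA ((-1) ^ (n + 1)) (cvalue f (take n as) c * as ! n))"
  by (intro module_hom_plus module_hom_sum module_hom_scaled module_hom_times act_body_hom
      cvalue_hom vector_space_algebra vector_space_cscale)

lemma cobd_add:
  assumes "f \<in> cochains sA sC n" "g \<in> cochains sA sC n"
  shows "cobdc n (f + g) = cobdc n f + cobdc n g"
  using assms module_hom.add[OF cvalue_cobd_hom]
  by (intro cochain_eqI[where n = "n + 1"] cobd_cochains cochains_add)
    (simp_all add: cvalue_cobd cochains_add module_hom.add[OF cvalue_hom])

lemma cobd_scale:
  assumes "f \<in> cochains sA sC n"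
  shows "cobdc n (cscale r f) = cscale r (cobdc n f)"
  using assms module_hom.scale[OF cvalue_cobd_hom]
  by (intro cochain_eqI[where n = "n + 1"] cobd_cochains cochains_scale)
    (simp_all add: cvalue_cobd cochains_scale module_hom.scale[OF cvalue_hom])

text \<open>Additivity at 0 + 0 reads x = x + x.\<close>

lemma cobd_zero: "cobdc n 0 = 0"
  using cobd_add[OF cochains_zero cochains_zero, of n] by simp

lemma cobd_cup:
  assumes f: "f \<in> cochains sA sC m" and g: "g \<in> cochains sA sC n"
  shows "cobdc (m + n) (cupc m n f g) =
    cupc (m + 1) n (cobdc m f) g + cscale ((-1) ^ m) (cupc m (n + 1) f (cobdc n g))"
proof (rule cochain_eqI[where n = "m + n + 1"])
  note fg = cup_cochains[OF f g] and df = cobd_cochains[OF f] and dg = cobd_cochains[OF g]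
  note dfg = cup_cochains[OF df g] and fdg = cup_cochains[OF f dg]
  show "cobdc (m + n) (cupc m n f g) \<in> cochains sA sC (m + n + 1)"
    by (rule cobd_cochains[OF fg])
  show "cupc (m + 1) n (cobdc m f) g + cscale ((-1) ^ m) (cupc m (n + 1) f (cobdc n g))
      \<in> cochains sA sC (m + n + 1)"
    using dfg fdg by (intro cochains_add cochains_scale) (simp_all add: ac_simps)
  fix as :: "'a list" and c
  assume len: "length as = m + n + 1"
  let ?s = "\<lambda>i. sA ((-1) ^ i)"
  \<comment> \<open>\<open>l\<close> is the part of the arguments seen by df and \<open>r\<close>
    the part seen by dg. They overlap in the entry \<open>as ! m\<close>, which is the last factor
    in df and the first acting element in dg.\<close>
  define l r where "l = take (m + 1) as" and "r = drop m as"
  have lr: "length l = m + 1" "length r = n + 1" "take m l = take m as" "drop 1 r = drop (m + 1) as"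
    "l ! 0 = as ! 0" "l ! m = as ! m" "r ! 0 = as ! m" "r ! n = as ! (m + n)"
    "take m (drop 1 as) = drop 1 l" "drop m (drop 1 as) = drop 1 r"
    "take m (take (m + n) as) = take m as" "drop m (take (m + n) as) = take n r"
    using len by (auto simp: l_def r_def min_def drop_take)
  let ?F = "cvalue f (take m as)" and ?G = "cvalue g (drop (m + 1) as)"
  let ?A = "conv (act (as ! 0) (cvalue f (drop 1 l))) ?G c"
  let ?M = "\<lambda>i. conv (cvalue f (merge i l)) ?G c"
  let ?N = "\<lambda>i. conv ?F (cvalue g (merge i r)) c"
  let ?Z = "conv ?F (cvalue g (take n r)) c * as ! (m + n)"
  let ?U = "conv (\<lambda>c. ?F c * as ! m) ?G c"
  have F1: "module_hom sC sA (cvalue f (drop 1 l))"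
    using lr by (intro cvalue_hom_coalgebra[OF f]) simp
  have G: "module_hom sC sA ?G"
    using len by (intro cvalue_hom_coalgebra[OF g]) simp

  have "cvalue (cupc m n f g) (drop 1 as) = conv (cvalue f (drop 1 l)) ?G"
    using len lr by (intro ext) (simp add: cvalue_cup[OF f g])
  \<comment> \<open>The action of the first argument passes to the left factor of the convolution,
    giving the term with which df begins.\<close>
  then have "act (as ! 0) (cvalue (cupc m n f g) (drop 1 as)) c = ?A"
    by (simp only: act_conv[OF F1 G])
  moreover have "cvalue (cupc m n f g) (take (m + n) as) c * as ! (m + n) = ?Z"
    using len lr by (simp add: cvalue_cup[OF f g])
  \<comment> \<open>The sum splits at \<open>m\<close>: the inner products up to \<open>m\<close>
    fall into \<open>l\<close>, the later ones, shifted by \<open>m\<close>, into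
    \<open>r\<close>.\<close>
  moreover have "(\<Sum>i = 1..m + n. ?s i (cvalue (cupc m n f g) (merge i as) c)) =
      (\<Sum>i = 1..m. ?s i (?M i)) + (\<Sum>i = 1..n. ?s (m + i) (?N i))"
  proof -
    have "cvalue (cupc m n f g) (merge i as) c = ?M i" if "1 \<le> i" "i \<le> m" for i
      using that len by (simp add: cvalue_cup[OF f g] length_merge merge_split_left l_def)
    moreover have "cvalue (cupc m n f g) (merge (m + i) as) c = ?N i" if "1 \<le> i" "i \<le> n" for i
      using that len by (simp add: cvalue_cup[OF f g] length_merge merge_split_right r_def)
    ultimately show ?thesis
      using sum.ub_add_nat[of 1 m "\<lambda>i. ?s i (cvalue (cupc m n f g) (merge i as) c)" n]
        sum.shift_bounds_cl_nat_ivl[of "\<lambda>i. ?s i (cvalue (cupc m n f g) (merge i as) c)" 1 m n]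
      by (simp add: add.commute)
  qed
  ultimately have lhs: "cvalue (cobdc (m + n) (cupc m n f g)) as c =
      ?A + ((\<Sum>i = 1..m. ?s i (?M i)) + (\<Sum>i = 1..n. ?s (m + i) (?N i))) + ?s (m + n + 1) ?Z"
    using len by (simp add: cvalue_cobd[OF fg])

  have "cvalue (cobdc m f) l = (\<lambda>c. act (as ! 0) (cvalue f (drop 1 l)) c +
      (\<Sum>i = 1..m. ?s i (cvalue f (merge i l) c)) + ?s (m + 1) (?F c * as ! m))"
    using lr by (simp add: cvalue_cobd[OF f] fun_eq_iff)
  moreover have "cvalue (cupc (m + 1) n (cobdc m f) g) as c = conv (cvalue (cobdc m f) l) ?G c"
    using cvalue_cup[OF df g, of as c] len by (simp add: l_def)
  ultimately have dfg: "cvalue (cupc (m + 1) n (cobdc m f) g) as c =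
      ?A + (\<Sum>i = 1..m. ?s i (?M i)) + ?s (m + 1) ?U"
    by (simp only: conv_linear_left[OF G])
  have "cvalue (cobdc n g) r = (\<lambda>c. act (as ! m) ?G c +
      (\<Sum>i = 1..n. ?s i (cvalue g (merge i r) c)) + ?s (n + 1) (cvalue g (take n r) c * as ! (m + n)))"
    using lr by (simp add: cvalue_cobd[OF g] fun_eq_iff)
  moreover have "cvalue (cupc m (n + 1) f (cobdc n g)) as c = conv ?F (cvalue (cobdc n g) r) c"
    using cvalue_cup[OF f dg, of as c] len by (simp add: r_def)
  ultimately have fdg: "cvalue (cupc m (n + 1) f (cobdc n g)) as c =
      ?U + (\<Sum>i = 1..n. ?s i (?N i)) + ?s (n + 1) ?Z"
    \<comment> \<open>\<open>conv_act\<close> turns the first term of dg into \<open>?U\<close>, the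
      last term of df without its sign; \<open>conv_mult_right\<close> takes the last argument out
      to give \<open>?Z\<close>.\<close>
    by (simp only: conv_linear_right conv_act[OF G] conv_mult_right)
  have "cvalue (cupc (m + 1) n (cobdc m f) g + cscale ((-1) ^ m) (cupc m (n + 1) f (cobdc n g))) as c =
      ?A + (\<Sum>i = 1..m. ?s i (?M i)) + ?s (m + 1) ?U +
      ?s m (?U + (\<Sum>i = 1..n. ?s i (?N i)) + ?s (n + 1) ?Z)"
    by (simp only: module_hom.add[OF cvalue_hom] module_hom.scale[OF cvalue_hom] dfg fdg)
  also have "\<dots> = ?A + ((\<Sum>i = 1..m. ?s i (?M i)) + (\<Sum>i = 1..n. ?s (m + i) (?N i))) +
      ?s (m + n + 1) ?Z"
    \<comment> \<open>The two copies of \<open>?U\<close> carry the signs (-1)^(m+1) and (-1)^m;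
      elsewhere the factor (-1)^m supplies the shift by \<open>m\<close> in the exponents.\<close>
    by (simp add: A.scale_right_distrib A.scale_right_diff_distrib A.scale_sum_right power_add)
  finally show "cvalue (cobdc (m + n) (cupc m n f g)) as c =
      cvalue (cupc (m + 1) n (cobdc m f) g + cscale ((-1) ^ m) (cupc m (n + 1) f (cobdc n g))) as c"
    using lhs by simp
qed

end

section \<open>The direct sum\<close>

text \<open>Both sides run over the pairs j \<le> i \<le> n, with k = i - j.\<close>

lemma sum_triangle:
  fixes f :: "nat \<Rightarrow> nat \<Rightarrow> 'a::comm_monoid_add"
  shows "(\<Sum>i\<le>n. \<Sum>j\<le>i. f i j) = (\<Sum>j\<le>n. \<Sum>k\<le>n - j. f (j + k) j)"
  unfolding sum.Sigma[OF finite_atMost ballI[OF finite_atMost]]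
  by (rule sum.reindex_bij_witness[where i = "\<lambda>(j, k). (j + k, j)" and j = "\<lambda>(i, j). (j, i - j)"]) auto

context entwining
begin

abbreviation scup where "scup \<equiv> sum_cup sA sC \<Delta> \<psi>"
abbreviation csum where "csum \<equiv> cochain_sum sA sC"

section \<open>The direct sum as a vector space\<close>

lemma cochain_sum_component: "F \<in> csum \<Longrightarrow> F n \<in> cochains sA sC n"
  by (simp add: cochain_sum_def)

lemma sum_scale_component: "sum_scale sA r F n = cscale r (F n)"
  by (simp add: sum_scale_def cscale_def)

lemma sum_cup_component: "scup F G n = (\<Sum>i\<le>n. cupc i (n - i) (F i) (G (n - i)))"
  by (simp add: sum_cup_def)

lemma homog_component: "homog n f i = (if i = n then f else 0)"
  by (simp add: homog_def)

lemma cochain_sum_zero: "0 \<in> csum"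
  by (simp add: cochain_sum_def cochains_zero)

lemma cochain_sum_add:
  assumes "F \<in> csum" "G \<in> csum"
  shows "F + G \<in> csum"
proof -
  have "{n. (F + G) n \<noteq> 0} \<subseteq> {n. F n \<noteq> 0} \<union> {n. G n \<noteq> 0}"
    by auto
  then show ?thesis
    using assms by (auto simp: cochain_sum_def cochains_add intro: finite_subset)
qed

lemma cscale_zero: "cscale r 0 = 0"
  by (auto simp: cscale_def)

lemma cochain_sum_scale:
  assumes "F \<in> csum"
  shows "sum_scale sA r F \<in> csum"
proof -
  have "{n. sum_scale sA r F n \<noteq> 0} \<subseteq> {n. F n \<noteq> 0}"
    by (auto simp: sum_scale_component cscale_zero)
  then show ?thesis
    using assms
    by (auto simp: cochain_sum_def sum_scale_component cochains_scale intro: finite_subset)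
qed

lemma vector_space_sum_scale: "vector_space (sum_scale sA)"
  by unfold_locales
    (auto simp: sum_scale_def fun_eq_iff A.scale_right_distrib A.scale_left_distrib)

section \<open>The product on the direct sum\<close>

lemma sum_cup_cochain_sum:
  assumes F: "F \<in> csum" and G: "G \<in> csum"
  shows "scup F G \<in> csum"
proof -
  note mem = cochain_sum_component[OF F] cochain_sum_component[OF G]
  have "scup F G n \<in> cochains sA sC n" for n
    unfolding sum_cup_def using cup_cochains[OF mem]
    by (intro cochains_sum) (metis atMost_iff le_add_diff_inverse)
  \<comment> \<open>Finite support: a nonzero term in degree \<open>n\<close> needs nonzero
    components whose degrees add up to \<open>n\<close>.\<close>
  moreover have "{n. scup F G n \<noteq> 0} \<subseteq> (\<lambda>(i, j). i + j) ` ({n. F n \<noteq> 0} \<times> {n. G n \<noteq> 0})"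
  proof
    fix n assume "n \<in> {n. scup F G n \<noteq> 0}"
    then obtain i where "i \<le> n" "cupc i (n - i) (F i) (G (n - i)) \<noteq> 0"
      by (auto simp: sum_cup_def elim: sum.not_neutral_contains_not_neutral)
    then have "(i, n - i) \<in> {n. F n \<noteq> 0} \<times> {n. G n \<noteq> 0}"
      by (auto simp: cup_zero_left cup_zero_right mem)
    with \<open>i \<le> n\<close> show "n \<in> (\<lambda>(i, j). i + j) ` ({n. F n \<noteq> 0} \<times> {n. G n \<noteq> 0})"
      by (force simp: image_iff)
  qed
  ultimately show ?thesis
    using F G by (auto simp: cochain_sum_def intro: finite_subset)
qed

lemma cscale_sum: "cscale r (sum f I) = (\<Sum>i\<in>I. cscale r (f i))"
proof -
  interpret K: vector_space cscale by (rule vector_space_cscale)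
  show ?thesis
    by (rule K.scale_sum_right)
qed

text \<open>Equality of families is unfolded in the degree only, so that the laws of
  \<open>cup\<close> apply to whole cochains.\<close>

lemma sum_cup_lin_map:
  assumes "F \<in> csum"
  shows "lin_map csum (sum_scale sA) csum (sum_scale sA) (scup F)"
    and "lin_map csum (sum_scale sA) csum (sum_scale sA) (\<lambda>G. scup G F)"
  using assms
  by (auto simp: lin_map_def sum_cup_cochain_sum fun_eq_iff[where 'a = nat] sum_scale_component
      sum_cup_component cup_add_left cup_add_right cup_scale_left cup_scale_right cochain_sum_component
      sum.distrib cscale_sum)

text \<open>In degree \<open>n\<close> both sides become sums over the decompositions of
  \<open>n\<close> into three degrees j, k and n - j - k, on which \<open>cup_assoc\<close> applies
  termwise.\<close>

lemma sum_cup_assoc: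
  assumes F: "F \<in> csum" and G: "G \<in> csum" and H: "H \<in> csum"
  shows "scup (scup F G) H = scup F (scup G H)"
proof
  fix n
  note mem = cochain_sum_component[OF F] cochain_sum_component[OF G] cochain_sum_component[OF H]
  have "scup (scup F G) H n =
      (\<Sum>i\<le>n. \<Sum>j\<le>i. cupc i (n - i) (cupc j (i - j) (F j) (G (i - j))) (H (n - i)))"
    unfolding sum_cup_def
  proof (intro sum.cong refl cup_sum_left mem)
    show "cupc j (i - j) (F j) (G (i - j)) \<in> cochains sA sC i" if "j \<in> {..i}" for i j
      using cup_cochains[OF mem(1,2), of j "i - j"] that by simp
  qed
  also have "\<dots> = (\<Sum>j\<le>n. \<Sum>k\<le>n - j.
      cupc (j + k) (n - (j + k)) (cupc j k (F j) (G k)) (H (n - (j + k))))"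
    by (simp add: sum_triangle)
  also have "\<dots> = (\<Sum>j\<le>n. \<Sum>k\<le>n - j.
      cupc j (n - j) (F j) (cupc k (n - j - k) (G k) (H (n - j - k))))"
  proof (intro sum.cong refl)
    fix j k assume "j \<in> {..n}" "k \<in> {..n - j}"
    then show "cupc (j + k) (n - (j + k)) (cupc j k (F j) (G k)) (H (n - (j + k))) =
        cupc j (n - j) (F j) (cupc k (n - j - k) (G k) (H (n - j - k)))"
      using cup_assoc[OF mem, of j k "n - j - k"] by simp
  qed
  also have "\<dots> = scup F (scup G H) n"
    unfolding sum_cup_def
  proof (intro sum.cong refl cup_sum_right[symmetric] mem)
    show "cupc k (j - k) (G k) (H (j - k)) \<in> cochains sA sC j" if "k \<in> {..j}" for j k
      using cup_cochains[OF mem(2,3), of k "j - k"] that by simp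
  qed
  finally show "scup (scup F G) H n = scup F (scup G H) n" .
qed

section \<open>Homogeneous elements and the unit\<close>

lemma homog_cochain: "f \<in> cochains sA sC n \<Longrightarrow> homog n f i \<in> cochains sA sC i"
  by (simp add: homog_def cochains_zero)

lemma homog_cochain_sum: "f \<in> cochains sA sC n \<Longrightarrow> homog n f \<in> csum"
  by (simp add: cochain_sum_def homog_cochain) (simp add: homog_def)

lemma sum_cup_homog_left:
  assumes f: "f \<in> cochains sA sC m" and G: "G \<in> csum"
  shows "scup (homog m f) G k = (if m \<le> k then cupc m (k - m) f (G (k - m)) else 0)"
proof -
  have "scup (homog m f) G k = (\<Sum>i\<le>k. if i = m then cupc m (k - m) f (G (k - m)) else 0)"
    unfolding sum_cup_def
    by (intro sum.cong) (auto simp: homog_def cup_zero_left cochain_sum_component[OF G])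
  then show ?thesis
    by simp
qed

lemma sum_cup_homog_right:
  assumes F: "F \<in> csum" and g: "g \<in> cochains sA sC n"
  shows "scup F (homog n g) k = (if n \<le> k then cupc (k - n) n (F (k - n)) g else 0)"
proof -
  \<comment> \<open>For \<open>k < n\<close> the truncated difference \<open>k - n\<close> is 0, a
    valid index; the inner test \<open>n \<le> k\<close> removes this spurious term.\<close>
  have "scup F (homog n g) k =
      (\<Sum>i\<le>k. if i = k - n then (if n \<le> k then cupc (k - n) n (F (k - n)) g else 0) else 0)"
    unfolding sum_cup_def
    by (intro sum.cong) (auto simp: homog_def cup_zero_right cochain_sum_component[OF F])
  then show ?thesis
    by simp
qed

lemma sum_cup_homog:
  assumes f: "f \<in> cochains sA sC m" and g: "g \<in> cochains sA sC n"
  shows "scup (homog m f) (homog n g) = homog (m + n) (cupc m n f g)"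
  by (rule ext)
    (auto simp: sum_cup_homog_left[OF f homog_cochain_sum[OF g]] homog_component cup_zero_right[OF f])

lemma assoc_algebra_cochain_sum:
  "assoc_algebra (sum_scale sA) csum scup (homog 0 unit_cochain)"
proof -
  interpret S: vector_space "sum_scale sA" by (rule vector_space_sum_scale)
  have "scup (homog 0 unit_cochain) F = F" "scup F (homog 0 unit_cochain) = F" if "F \<in> csum" for F
    by (rule ext, simp add: sum_cup_homog_left[OF unit_cochain that] sum_cup_homog_right[OF that unit_cochain]
        cup_unit_left cup_unit_right cochain_sum_component[OF that])+
  then show ?thesis
    unfolding assoc_algebra_def S.subspace_def
    by (simp add: vector_space_sum_scale cochain_sum_zero cochain_sum_add cochain_sum_scale
        sum_cup_lin_map sum_cup_assoc homog_cochain_sum[OF unit_cochain])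
qed

section \<open>The coboundary on the direct sum\<close>

lemma sum_cobd_lin_map: "lin_map csum (sum_scale sA) csum (sum_scale sA) (sum_cobd sA sC \<psi>)"
proof -
  have "sum_cobd sA sC \<psi> F \<in> csum" if F: "F \<in> csum" for F
  proof -
    \<comment> \<open>The support moves up by at most one degree, because the coboundary of 0 is
      0.\<close>
    have "n \<in> Suc ` {n. F n \<noteq> 0}" if "sum_cobd sA sC \<psi> F n \<noteq> 0" for n
      using that by (cases n) (auto simp: sum_cobd_def cobd_zero)
    then have "{n. sum_cobd sA sC \<psi> F n \<noteq> 0} \<subseteq> Suc ` {n. F n \<noteq> 0}"
      by blast
    moreover have "sum_cobd sA sC \<psi> F n \<in> cochains sA sC n" for n
      using cobd_cochains[OF cochain_sum_component[OF F]]
      by (auto simp: sum_cobd_def cochains_zero split: nat.splits)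
    ultimately show ?thesis
      using F by (auto simp: cochain_sum_def intro: finite_subset)
  qed
  then show ?thesis
    by (auto simp: lin_map_def fun_eq_iff[where 'a = nat] sum_cobd_def sum_scale_component cobd_add
        cobd_scale cscale_zero cochain_sum_component split: nat.splits)
qed

lemma sum_cobd_homog: "sum_cobd sA sC \<psi> (homog n f) = homog (n + 1) (cobdc n f)"
  by (auto simp: sum_cobd_def homog_def fun_eq_iff[where 'a = nat] cobd_zero split: nat.splits)

end

text \<open>The clauses about pure tensors tie \<open>cup\<close> and \<open>cobd\<close>, which are
  defined through chosen representatives, to the displayed formulas. The clauses about
  \<open>homog\<close> identify the operations on the direct sum with those on single
  degrees.\<close>

theorem lemma4p2:
  fixes sA :: "'k::field \<Rightarrow> 'a::{ring, monoid_mult} \<Rightarrow> 'a"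
    and sC :: "'k \<Rightarrow> 'c::ab_group_add \<Rightarrow> 'c"
    and \<Delta> :: "'c \<Rightarrow> ('c \<times> 'c \<Rightarrow>\<^sub>0 'k) set"
    and \<epsilon> :: "'c \<Rightarrow> 'k"
    and \<psi> :: "('c \<times> 'a \<Rightarrow>\<^sub>0 'k) set \<Rightarrow> ('a \<times> 'c \<Rightarrow>\<^sub>0 'k) set"
  assumes "entwining sA sC \<Delta> \<epsilon> \<psi>"
  shows
    "(\<exists>e. assoc_algebra (sum_scale sA) (cochain_sum sA sC) (sum_cup sA sC \<Delta> \<psi>) e) \<and>
     (\<forall>m n. \<forall>f\<in>cochains sA sC m. \<forall>g\<in>cochains sA sC n.
       cup sA sC \<Delta> \<psi> m n f g \<in> cochains sA sC (m + n) \<and>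
       (\<forall>c as. length as = m + n \<longrightarrow>
          cup sA sC \<Delta> \<psi> m n f g (tensn sC sA c as) = cup_val sA sC \<Delta> \<psi> m f g (c, as)) \<and>
       sum_cup sA sC \<Delta> \<psi> (homog m f) (homog n g) = homog (m + n) (cup sA sC \<Delta> \<psi> m n f g)) \<and>
     (lin_map (cochain_sum sA sC) (sum_scale sA) (cochain_sum sA sC) (sum_scale sA) (sum_cobd sA sC \<psi>)) \<and>
     (\<forall>n. \<forall>f\<in>cochains sA sC n.
       cobd sA sC \<psi> n f \<in> cochains sA sC (n + 1) \<and>
       (\<forall>c as. length as = n + 1 \<longrightarrow>
          cobd sA sC \<psi> n f (tensn sC sA c as) = cobd_val sA sC \<psi> n f (c, as)) \<and>
       sum_cobd sA sC \<psi> (homog n f) = homog (n + 1) (cobd sA sC \<psi> n f)) \<and>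
     (\<forall>m n. \<forall>f\<in>cochains sA sC m. \<forall>g\<in>cochains sA sC n.
       cobd sA sC \<psi> (m + n) (cup sA sC \<Delta> \<psi> m n f g) =
       cup sA sC \<Delta> \<psi> (m + 1) n (cobd sA sC \<psi> m f) g +
       (\<lambda>X. sA ((-1) ^ m) (cup sA sC \<Delta> \<psi> m (n + 1) f (cobd sA sC \<psi> n g) X)))"
proof -
  interpret entwining sA sC \<Delta> \<epsilon> \<psi> by fact
  show ?thesis
  proof (intro conjI allI ballI impI exI)
    fix m n f g and c :: 'c and as :: "'a list"
    assume f: "f \<in> cochains sA sC m" and g: "g \<in> cochains sA sC n"
    show "cupc m n f g \<in> cochains sA sC (m + n)"
      by (rule cup_cochains[OF f g])
    show "cupc m n f g (tensn sC sA c as) = cup_val sA sC \<Delta> \<psi> m f g (c, as)" if "length as = m + n"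
      using cvalue_cup[OF f g that] by (simp add: cvalue_def cup_val_conv)
    show "scup (homog m f) (homog n g) = homog (m + n) (cupc m n f g)"
      by (rule sum_cup_homog[OF f g])
    show "cobdc (m + n) (cupc m n f g) =
        cupc (m + 1) n (cobdc m f) g + (\<lambda>X. sA ((-1) ^ m) (cupc m (n + 1) f (cobdc n g) X))"
      using cobd_cup[OF f g] by (simp add: cscale_def)
    show "cobdc m f \<in> cochains sA sC (m + 1)"
      by (rule cobd_cochains[OF f])
    show "cobdc m f (tensn sC sA c as) = cobd_val sA sC \<psi> m f (c, as)" if "length as = m + 1"
      using cvalue_cobd[OF f that] by (simp add: cvalue_def cobd_val_act)
    show "sum_cobd sA sC \<psi> (homog m f) = homog (m + 1) (cobdc m f)"
      by (rule sum_cobd_homog)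
  qed (rule assoc_algebra_cochain_sum sum_cobd_lin_map)+
qed

end
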